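(* Let $t\ge 3$ be an integer, and let $\alpha_t$ be the positive solution to the quadratic $\alpha = 1-\frac{1}{t-2}\alpha^2$; that is, $\alpha_t = 1-\frac{t-\sqrt{t^2-4}}{2}$. Then $\pi_{rt}(rK_t)\ge\alpha_t$ for all integers $r\ge1$, and $$\lim_{r\to\infty}\pi_{rt}(rK_t)=\alpha_t.$$
   Context: Graphs are finite and simple. An $m$-partite graph $G$ is a graph with a vertex partition $V = V_1\sqcup\dots\sqcup V_m$ into nonempty parts such that no edge has both ends in the same part. For disjoint nonempty vertex sets $X,Y$, the edge density is $d(X,Y) = \frac{e(X,Y)}{|X||Y|}$, where $e(X,Y)$ is the number of edges between $X$ and $Y$. The $m$-partite density of $G$ is $d_m(G) = \min_{1\le i<j\le m} d(V_i,V_j)$. A traversal of $G$ is a subgraph (on $m$ vertices) containing exactly one vertex from each part. For a graph $F$, $G$ contains an $F$-traversal if some traversal of $G$ contains $F$ as a subgraph (up to isomorphism). The critical density is $$\pi_m(F) = \sup\{\alpha\in[0,1] : \text{there exists an } m\text{-partite graph } G \text{ with } d_m(G)\ge\alpha \text{ and no } F\text{-traversal}\}.$$ $rK_t$ denotes the graph consisting of $r$ vertex-disjoint copies of the complete graph $K_t$. *)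

theory Defs
  imports Complex_Main
begin

record 'a ugraph =
  verts :: "'a set"
  edges :: "'a set set"

definition simple_graph :: "'a ugraph \<Rightarrow> bool" where
  "simple_graph G \<longleftrightarrow> finite (verts G) \<and> (\<forall>e\<in>edges G. e \<subseteq> verts G \<and> card e = 2)"

text \<open>The parts \<open>V\<^sub>1, \<dots>, V\<^sub>m\<close> are \<open>P 0, \<dots>, P (m - 1)\<close>; values of \<open>P\<close> beyond \<open>m\<close> play no role.\<close>

definition multipartite :: "nat \<Rightarrow> 'a ugraph \<Rightarrow> (nat \<Rightarrow> 'a set) \<Rightarrow> bool" where
  "multipartite m G P \<longleftrightarrow>
     simple_graph G \<and>
     (\<Union>i<m. P i) = verts G \<and>
     (\<forall>i<m. P i \<noteq> {}) \<and>
     (\<forall>i<m. \<forall>j<m. i \<noteq> j \<longrightarrow> P i \<inter> P j = {}) \<and>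
     (\<forall>e\<in>edges G. \<forall>i<m. \<not> e \<subseteq> P i)"

definition edges_between :: "'a ugraph \<Rightarrow> 'a set \<Rightarrow> 'a set \<Rightarrow> 'a set set" where
  "edges_between G X Y = {e \<in> edges G. \<exists>x\<in>X. \<exists>y\<in>Y. e = {x, y}}"

definition edge_density :: "'a ugraph \<Rightarrow> 'a set \<Rightarrow> 'a set \<Rightarrow> real" where
  "edge_density G X Y = real (card (edges_between G X Y)) / (real (card X) * real (card Y))"

text \<open>Meaningful for \<open>m \<ge> 2\<close> only: otherwise the minimum is over the empty set.\<close>

definition multipartite_density :: "nat \<Rightarrow> 'a ugraph \<Rightarrow> (nat \<Rightarrow> 'a set) \<Rightarrow> real" where
  "multipartite_density m G P = Min {edge_density G (P i) (P j) | i j. i < j \<and> j < m}"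

definition subgraph :: "'a ugraph \<Rightarrow> 'a ugraph \<Rightarrow> bool" where
  "subgraph H G \<longleftrightarrow> simple_graph H \<and> verts H \<subseteq> verts G \<and> edges H \<subseteq> edges G"

definition traversal :: "nat \<Rightarrow> 'a ugraph \<Rightarrow> (nat \<Rightarrow> 'a set) \<Rightarrow> 'a ugraph \<Rightarrow> bool" where
  "traversal m G P H \<longleftrightarrow>
     subgraph H G \<and> card (verts H) = m \<and> (\<forall>i<m. card (verts H \<inter> P i) = 1)"

text \<open>\<open>contains_copy H F\<close>: some (not necessarily induced) subgraph of \<open>H\<close> is isomorphic to \<open>F\<close>.\<close>

definition contains_copy :: "'a ugraph \<Rightarrow> 'b ugraph \<Rightarrow> bool" where
  "contains_copy H F \<longleftrightarrow>
     (\<exists>f. inj_on f (verts F) \<and> f ` verts F \<subseteq> verts H \<and> (\<forall>e\<in>edges F. f ` e \<in> edges H))"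

definition contains_traversal ::
    "nat \<Rightarrow> 'a ugraph \<Rightarrow> (nat \<Rightarrow> 'a set) \<Rightarrow> 'b ugraph \<Rightarrow> bool" where
  "contains_traversal m G P F \<longleftrightarrow> (\<exists>H. traversal m G P H \<and> contains_copy H F)"

text \<open>All graphs being finite, taking the host graphs on vertices of type \<^typ>\<open>nat\<close> loses none of
  them up to isomorphism.\<close>

definition critical_density :: "nat \<Rightarrow> 'b ugraph \<Rightarrow> real" where
  "critical_density m F =
     Sup {\<alpha>. 0 \<le> \<alpha> \<and> \<alpha> \<le> 1 \<and>
        (\<exists>(G :: nat ugraph) P. multipartite m G P \<and> multipartite_density m G P \<ge> \<alpha> \<and>
           \<not> contains_traversal m G P F)}"

text \<open>The graph \<open>r K\<^sub>t\<close>; the vertex \<open>(i, a)\<close> is vertex \<open>a\<close> of the \<open>i\<close>-th copy.\<close>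

definition copies_complete :: "nat \<Rightarrow> nat \<Rightarrow> (nat \<times> nat) ugraph" where
  "copies_complete r t =
     \<lparr>verts = {..<r} \<times> {..<t},
      edges = {{(i, a), (i, b)} | i a b. i < r \<and> a < t \<and> b < t \<and> a \<noteq> b}\<rparr>"

definition alpha_crit :: "nat \<Rightarrow> real" where
  "alpha_crit t = (THE x. 0 < x \<and> x = 1 - 1 / (real t - 2) * x\<^sup>2)"

end

theory Submission
  imports Defs "HOL-Library.Ramsey" "HOL-Library.Disjoint_Sets"
begin

text \<open>Lower bound: let the vertices of one part see the same fraction \<open>x\<close> of every other part, and
  let these neighbourhoods span a balanced complete \<open>(t - 2)\<close>-partite pattern. No \<open>K\<^sub>t\<close> meets the
  special part, and the densities are \<open>x\<close> and \<open>1 - x\<^sup>2 / (t - 2)\<close>, which balance at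
  \<open>x = \<alpha>\<^sub>t\<close>.

  Upper bound: suppose all densities are at least \<open>\<alpha>\<^sub>t + \<epsilon>\<close>, and call a \<open>t\<close>-set of parts an edge if
  it has a transversal \<open>K\<^sub>t\<close>. Given a part \<open>i\<close> and a large bounded number of other parts, some vertex
  of part \<open>i\<close> sees a fraction at least \<open>\<alpha>\<^sub>t\<close> of many of them; among these neighbourhoods the density
  exceeds \<open>1 - 1 / (t - 2)\<close>, and Turan's theorem for the weights \<open>1 / |N\<^sub>j|\<close> yields a \<open>K\<^bsub>t-1\<^esub>\<close>. So
  every \<open>i\<close> forms an edge with some \<open>t - 1\<close> elements of any set of \<open>L\<close> other parts. A \<open>t\<close>-uniform
  hypergraph with this property has a perfect matching once it is large: a maximal matching misses a
  set \<open>S\<close> of at most \<open>L\<close> vertices. Label the vertices of each matching edge by \<open>0, \<dots>, t - 1\<close>. By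
  Ramsey's theorem there are many matching edges such that any \<open>t\<close> equally labelled vertices of
  them form an edge, and any \<open>t - 1\<close> vertices labelled \<open>0\<close> form an edge with each element of \<open>S\<close>.
  Now rematch \<open>S\<close> with \<open>(t - 1) |S|\<close> of these edges: their label \<open>0\<close> vertices absorb \<open>S\<close>, and the
  vertices of every other label are matched among themselves.\<close>

subsection \<open>Perfect matchings in hypergraphs with dense links\<close>

text \<open>Ramsey's theorem for two colours of \<open>p\<close>-sets, \<open>Q\<close> or not
  \<open>Q\<close>: the assumption rules out a \<open>q\<close>-set of the second colour, which
  leaves an \<open>n\<close>-set of the first. The bound \<open>N\<close> serves every
  \<open>A\<close> and \<open>Q\<close>.\<close>

lemma ramsey_forcing:
  "\<exists>N::nat. \<forall>A::nat set. finite A \<longrightarrow> N \<le> card A \<longrightarrow>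
     (\<forall>Q. (\<forall>B\<subseteq>A. card B = q \<longrightarrow> (\<exists>T\<subseteq>B. card T = p \<and> Q T)) \<longrightarrow>
       (\<exists>A'\<subseteq>A. card A' = n \<and> (\<forall>T\<subseteq>A'. card T = p \<longrightarrow> Q T)))"
proof -
  obtain N :: nat where N: "partn_lst {..<N} [n, q] p"
    using ramsey2_full by blast
  show ?thesis
  proof (intro exI[of _ N] allI impI)
    fix A :: "nat set" and Q
    assume A: "finite A" "N \<le> card A"
      and Q: "\<forall>B\<subseteq>A. card B = q \<longrightarrow> (\<exists>T\<subseteq>B. card T = p \<and> Q T)"
    obtain A1 where A1: "A1 \<subseteq> A" "card A1 = N" "finite A1"
      using A by (metis obtain_subset_with_card_n)
    \<comment> \<open>Ramsey's theorem speaks of \<open>{..<N}\<close>; \<open>h\<close> pulls the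
      colouring back from subsets of \<open>A1\<close>.\<close>
    obtain h where h: "bij_betw h {..<N} A1"
      using A1 by (metis bij_betw_from_nat_into_finite)
    have inj: "inj_on h X" if "X \<subseteq> {..<N}" for X
      using h that by (meson bij_betw_def inj_on_subset)
    have cardh: "card (h ` X) = card X" if "X \<subseteq> {..<N}" for X
      using inj[OF that] card_image by blast
    have img: "h ` X \<subseteq> A" if "X \<subseteq> {..<N}" for X
      using h that A1 unfolding bij_betw_def by blast
    define f where "f T = (if Q (h ` T) then 0 else (1::nat))" for T
    have "f \<in> [{..<N}]\<^bsup>p\<^esup> \<rightarrow> {..<length [n, q]}"
      by (auto simp: f_def)
    then obtain i where "i < length [n, q]" "monochromatic {..<N} ([n, q] ! i) p f i"
      using N unfolding partn_lst_def by blast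
    then consider "monochromatic {..<N} n p f 0" | "monochromatic {..<N} q p f 1"
      by (auto simp: less_Suc_eq)
    then show "\<exists>A'\<subseteq>A. card A' = n \<and> (\<forall>T\<subseteq>A'. card T = p \<longrightarrow> Q T)"
    proof cases
      case 1
      then obtain X where X: "X \<subseteq> {..<N}" "finite X" "card X = n" "\<And>T. T \<in> [X]\<^bsup>p\<^esup> \<Longrightarrow> f T = 0"
        unfolding monochromatic_def by (auto simp: nsets_def)
      have "Q T" if T: "T \<subseteq> h ` X" "card T = p" for T
      proof -
        obtain T' where T': "T' \<subseteq> X" "T = h ` T'"
          using T by (meson subset_imageE)
        then have "T' \<in> [X]\<^bsup>p\<^esup>"
          using T X cardh[of T'] finite_subset[of T' X] by (auto simp: nsets_def)
        from X(4)[OF this] show ?thesis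
          using T' by (simp add: f_def split: if_splits)
      qed
      then show ?thesis
        using X img[of X] cardh[of X] by blast
    next
      case 2
      then obtain X where X: "X \<subseteq> {..<N}" "finite X" "card X = q" "\<And>T. T \<in> [X]\<^bsup>p\<^esup> \<Longrightarrow> f T = 1"
        unfolding monochromatic_def by (auto simp: nsets_def)
      then obtain T where T: "T \<subseteq> h ` X" "card T = p" "Q T"
        using Q img[of X] cardh[of X] by metis
      obtain T' where T': "T' \<subseteq> X" "T = h ` T'"
        using T by (meson subset_imageE)
      then have "T' \<in> [X]\<^bsup>p\<^esup>"
        using T X cardh[of T'] finite_subset[of T' X] by (auto simp: nsets_def)
      from X(4)[OF this] T T' show ?thesis
        by (simp add: f_def)
    qed
  qed
qed

text \<open>The predicates \<open>Q d\<close> are treated one at a time, since the assumption on the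
  remaining ones passes to every subset of \<open>A\<close>. The bound depends on \<open>D\<close>
  only through \<open>k\<close>, so it can be fixed before \<open>D\<close> is known.\<close>

lemma ramsey_forcing_family:
  "\<exists>N::nat. \<forall>A::nat set. finite A \<longrightarrow> N \<le> card A \<longrightarrow>
     (\<forall>(D::'d set) Q. finite D \<longrightarrow> card D \<le> k \<longrightarrow>
       (\<forall>d\<in>D. \<forall>B\<subseteq>A. card B = q \<longrightarrow> (\<exists>T\<subseteq>B. card T = p \<and> Q d T)) \<longrightarrow>
       (\<exists>A'\<subseteq>A. card A' = n \<and> (\<forall>d\<in>D. \<forall>T\<subseteq>A'. card T = p \<longrightarrow> Q d T)))"
proof (induction k)
  case 0
  show ?case
    by (rule exI[of _ n]) (auto elim: obtain_subset_with_card_n)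
next
  case (Suc k)
  then obtain N where N: "\<forall>A::nat set. finite A \<longrightarrow> N \<le> card A \<longrightarrow>
     (\<forall>(D::'d set) Q. finite D \<longrightarrow> card D \<le> k \<longrightarrow>
       (\<forall>d\<in>D. \<forall>B\<subseteq>A. card B = q \<longrightarrow> (\<exists>T\<subseteq>B. card T = p \<and> Q d T)) \<longrightarrow>
       (\<exists>A'\<subseteq>A. card A' = n \<and> (\<forall>d\<in>D. \<forall>T\<subseteq>A'. card T = p \<longrightarrow> Q d T)))"
    by (elim exE) (rule that)
  note N = N[THEN spec, THEN mp, THEN mp, THEN spec, THEN spec, THEN mp, THEN mp, THEN mp]
  obtain N' where N': "\<forall>A::nat set. finite A \<longrightarrow> N' \<le> card A \<longrightarrow>
     (\<forall>Q. (\<forall>B\<subseteq>A. card B = q \<longrightarrow> (\<exists>T\<subseteq>B. card T = p \<and> Q T)) \<longrightarrow>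
       (\<exists>A'\<subseteq>A. card A' = N \<and> (\<forall>T\<subseteq>A'. card T = p \<longrightarrow> Q T)))"
    using ramsey_forcing[of q p N] by (elim exE) (rule that)
  note N' = N'[THEN spec, THEN mp, THEN mp, THEN spec, THEN mp]
  show ?case
  proof (intro exI[of _ "max N N'"] allI impI)
    fix A :: "nat set" and D :: "'d set" and Q
    assume A: "finite A" "max N N' \<le> card A" and D: "finite D" "card D \<le> Suc k"
      and Q: "\<forall>d\<in>D. \<forall>B\<subseteq>A. card B = q \<longrightarrow> (\<exists>T\<subseteq>B. card T = p \<and> Q d T)"
    show "\<exists>A'\<subseteq>A. card A' = n \<and> (\<forall>d\<in>D. \<forall>T\<subseteq>A'. card T = p \<longrightarrow> Q d T)"
    proof (cases "D = {}")
      case True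
      with N[OF A(1), of D Q] A(2) show ?thesis by simp
    next
      case False
      then obtain d where d: "d \<in> D" by blast
      from A(2) have A2: "N' \<le> card A" by simp
      \<comment> \<open>First homogeneity for \<open>Q d\<close>, keeping enough elements for the
        induction hypothesis on the other predicates.\<close>
      obtain A1 where A1: "A1 \<subseteq> A" "card A1 = N" "\<forall>T\<subseteq>A1. card T = p \<longrightarrow> Q d T"
        using N'[OF A(1) A2, of "Q d"] Q d by meson
      have "\<exists>A'\<subseteq>A1. card A' = n \<and> (\<forall>e\<in>D-{d}. \<forall>T\<subseteq>A'. card T = p \<longrightarrow> Q e T)"
      proof (rule N)
        show "finite A1" "N \<le> card A1" "finite (D - {d})" "card (D - {d}) \<le> k"
          using A1 A D d by (auto intro: finite_subset)
        show "\<forall>e\<in>D - {d}. \<forall>B\<subseteq>A1. card B = q \<longrightarrow> (\<exists>T\<subseteq>B. card T = p \<and> Q e T)"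
          using Q A1(1) by (meson DiffD1 subset_trans)
      qed
      then obtain A' where A': "A' \<subseteq> A1" "card A' = n" "\<forall>e\<in>D-{d}. \<forall>T\<subseteq>A'. card T = p \<longrightarrow> Q e T"
        by blast
      have "\<forall>e\<in>D. \<forall>T\<subseteq>A'. card T = p \<longrightarrow> Q e T"

      proof (intro ballI allI impI)
        fix e T
        assume "e \<in> D" "T \<subseteq> A'" "card T = p"
        then show "Q e T"
          using A' A1(3) by (cases "e = d") auto
      qed
      then show ?thesis
        using A'(1,2) A1(1) by (intro exI[of _ A']) auto
    qed
  qed
qed

section \<open>Perfect matchings of hypergraphs, assembled from disjoint pieces\<close>

definition tileable :: "'a set set \<Rightarrow> 'a set \<Rightarrow> bool" where
  "tileable H X \<longleftrightarrow> (\<exists>M\<subseteq>H. finite M \<and> disjoint M \<and> \<Union>M = X)"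

lemma tileable_empty: "tileable H {}"
  unfolding tileable_def by (rule exI[of _ "{}"]) auto

lemma tileable_Un:
  assumes "tileable H X" "tileable H Y" "X \<inter> Y = {}"
  shows "tileable H (X \<union> Y)"
proof -
  obtain M N where M: "M \<subseteq> H" "finite M" "disjoint M" "\<Union>M = X"
    and N: "N \<subseteq> H" "finite N" "disjoint N" "\<Union>N = Y"
    using assms unfolding tileable_def by blast
  have "disjoint (M \<union> N)"
    using M N assms(3) by (intro disjoint_union) auto
  then show ?thesis
    unfolding tileable_def using M N by (intro exI[of _ "M \<union> N"]) auto
qed

lemma tileable_single: "e \<in> H \<Longrightarrow> tileable H e"
  unfolding tileable_def by (rule exI[of _ "{e}"]) auto

lemma tileable_UN:
  assumes "finite I" "\<And>i. i \<in> I \<Longrightarrow> tileable H (X i)" "disjoint_family_on X I"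
  shows "tileable H (\<Union>i\<in>I. X i)"
  using assms
proof (induction I rule: finite_induct)
  case empty
  then show ?case by (simp add: tileable_empty)
next
  case (insert i I)
  have "tileable H (\<Union>j\<in>I. X j)"
    using insert by (simp add: disjoint_family_on_insert)
  moreover have "X i \<inter> (\<Union>j\<in>I. X j) = {}"
    using insert by (simp add: disjoint_family_on_insert)
  ultimately show ?case
    using tileable_Un[of H "X i"] insert.prems by simp
qed

text \<open>Edges can be split off greedily, because what remains is again complete and has
  \<open>t\<close> fewer elements.\<close>

lemma tileable_complete:
  assumes "finite X" "t dvd card X" "\<And>T. T \<subseteq> X \<Longrightarrow> card T = t \<Longrightarrow> T \<in> H"
  shows "tileable H X"
proof -
  obtain n where "card X = n * t"
    using assms(2) by (metis dvd_def mult.commute)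
  with assms(1,3) show ?thesis
  proof (induction n arbitrary: X)
    case 0
    then show ?case by (simp add: tileable_empty)
  next
    case (Suc n)
    then obtain T where T: "T \<subseteq> X" "card T = t" "finite T"
      by (metis obtain_subset_with_card_n le_add1 mult_Suc)
    have "tileable H (X - T)"
      using Suc T by (intro Suc.IH) (auto simp: card_Diff_subset)
    then have "tileable H (T \<union> (X - T))"
      using Suc.prems(2) T tileable_Un[OF tileable_single, of T H "X - T"] by auto
    moreover have "T \<union> (X - T) = X" using T by auto
    ultimately show ?case by simp
  qed
qed

text \<open>Each element of \<open>S\<close> takes its own \<open>p\<close> elements of
  \<open>X\<close>, which uses up \<open>X\<close> exactly. This absorbs the vertices missed by a
  maximal matching.\<close>

lemma tileable_stars:
  assumes "finite S" "finite X" "S \<inter> X = {}" "card X = card S * p"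
    and "\<And>s T. s \<in> S \<Longrightarrow> T \<subseteq> X \<Longrightarrow> card T = p \<Longrightarrow> insert s T \<in> H"
  shows "tileable H (S \<union> X)"
  using assms
proof (induction S arbitrary: X rule: finite_induct)
  case empty
  then show ?case by (simp add: tileable_empty)
next
  case (insert s S)
  then obtain T where T: "T \<subseteq> X" "card T = p" "finite T"
    by (metis obtain_subset_with_card_n le_add1 mult_Suc card_insert_disjoint)
  have "insert a U \<in> H" if "a \<in> S" "U \<subseteq> X - T" "card U = p" for a U
    using that by (intro insert.prems) auto
  then have "tileable H (S \<union> (X - T))"
    using insert.hyps insert.prems(1-3) T by (intro insert.IH) (auto simp: card_Diff_subset)
  moreover have "insert s T \<in> H"
    using T by (intro insert.prems) auto
  ultimately have "tileable H (insert s T \<union> (S \<union> (X - T)))"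
    using insert.hyps insert.prems(2) T tileable_Un[OF tileable_single, of "insert s T" H] by auto
  moreover have "insert s T \<union> (S \<union> (X - T)) = insert s S \<union> X" using T by auto
  ultimately show ?case by simp
qed

text \<open>\<open>L\<close> stays fixed while \<open>V\<close> grows, so a maximal matching misses
  boundedly many vertices and Ramsey's theorem finds room to absorb them.\<close>

lemma perfect_tiling:
  assumes t: "1 \<le> t"
  shows "\<exists>m0. \<forall>(V::'a set) H. finite V \<longrightarrow> m0 \<le> card V \<longrightarrow> t dvd card V \<longrightarrow> (\<forall>e\<in>H. card e = t) \<longrightarrow>
    (\<forall>i\<in>V. \<forall>J\<subseteq>V - {i}. card J = L \<longrightarrow> (\<exists>T\<subseteq>J. card T = t - 1 \<and> insert i T \<in> H)) \<longrightarrow>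
    tileable H V"
proof -
  \<comment> \<open>The Ramsey bounds are chosen in reverse order of use: \<open>N2\<close> has to
    leave \<open>N1\<close> indices for the step that treats the missed vertices. That step keeps
    \<open>L * (t - 1)\<close> indices, since at most \<open>L\<close> missed vertices need
    \<open>t - 1\<close> each.\<close>
  obtain N1 where N1: "\<forall>A::nat set. finite A \<longrightarrow> N1 \<le> card A \<longrightarrow>
     (\<forall>(D::'a set) Q. finite D \<longrightarrow> card D \<le> L \<longrightarrow>
       (\<forall>d\<in>D. \<forall>B\<subseteq>A. card B = L \<longrightarrow> (\<exists>T\<subseteq>B. card T = t - 1 \<and> Q d T)) \<longrightarrow>
       (\<exists>A'\<subseteq>A. card A' = L * (t - 1) \<and> (\<forall>d\<in>D. \<forall>T\<subseteq>A'. card T = t - 1 \<longrightarrow> Q d T)))"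
    using ramsey_forcing_family[where 'd='a and k=L and q=L and p="t - 1" and n="L * (t - 1)"] by (elim exE) (rule that)
  note N1 = N1[THEN spec, THEN mp, THEN mp, THEN spec, THEN spec, THEN mp, THEN mp, THEN mp]
  obtain N2 where N2: "\<forall>A::nat set. finite A \<longrightarrow> N2 \<le> card A \<longrightarrow>
     (\<forall>(D::nat set) Q. finite D \<longrightarrow> card D \<le> t \<longrightarrow>
       (\<forall>d\<in>D. \<forall>B\<subseteq>A. card B = L + 1 \<longrightarrow> (\<exists>T\<subseteq>B. card T = t \<and> Q d T)) \<longrightarrow>
       (\<exists>A'\<subseteq>A. card A' = N1 \<and> (\<forall>d\<in>D. \<forall>T\<subseteq>A'. card T = t \<longrightarrow> Q d T)))"
    using ramsey_forcing_family[where 'd=nat and k=t and q="L + 1" and p=t and n=N1] by (elim exE) (rule that)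
  note N2 = N2[THEN spec, THEN mp, THEN mp, THEN spec, THEN spec, THEN mp, THEN mp, THEN mp]
  show ?thesis
  \<comment> \<open>With at most \<open>L\<close> vertices missed, this many vertices force at least
    \<open>N2\<close> matching edges.\<close>
  proof (intro exI[of _ "t * N2 + L"] allI impI)
    fix V :: "'a set" and H
    assume V: "finite V" and m0: "t * N2 + L \<le> card V" and dvd: "t dvd card V"
      and H: "\<forall>e\<in>H. card e = t"
      and link': "\<forall>i\<in>V. \<forall>J\<subseteq>V - {i}. card J = L \<longrightarrow> (\<exists>T\<subseteq>J. card T = t - 1 \<and> insert i T \<in> H)"
    have link: "\<exists>T\<subseteq>J. card T = t - 1 \<and> insert i T \<in> H" if "i \<in> V" "J \<subseteq> V" "i \<notin> J" "card J = L" for i J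
      using link' that by blast
    have Hfin: "finite e" if "e \<in> H" for e
      using H t that by (metis card.infinite not_one_le_zero)
    define \<M> where "\<M> = {M. M \<subseteq> {e\<in>H. e \<subseteq> V} \<and> disjoint M}"
    have "\<M> \<subseteq> Pow (Pow V)" by (auto simp: \<M>_def)
    then have "finite \<M>" using V by (simp add: finite_subset)
    moreover have "{} \<in> \<M>" by (simp add: \<M>_def)
    ultimately obtain M where "M \<in> \<M>" and max: "\<And>N. N \<in> \<M> \<Longrightarrow> M \<subseteq> N \<Longrightarrow> M = N"
      by (metis empty_iff finite_has_maximal)
    then have M: "M \<subseteq> H" "\<And>e. e \<in> M \<Longrightarrow> e \<subseteq> V" and dM: "disjoint M"
      by (auto simp: \<M>_def)
    have finM: "finite M"
      using V M(2) by (meson Pow_iff finite_Pow_iff finite_subset subsetI)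
    define S where "S = V - \<Union>M"
    have finS: "finite S" using V by (simp add: S_def)
    \<comment> \<open>More than \<open>L\<close> missed vertices would contain an edge disjoint from
      \<open>M\<close>, against maximality.\<close>
    have cardS: "card S \<le> L"
    proof (rule ccontr)
      assume "\<not> card S \<le> L"
      then obtain i S' where S': "S = insert i S'" "i \<notin> S'" "L \<le> card S'"
        by (metis Suc_le_eq card_le_Suc_iff less_eq_Suc_le not_le)
      then obtain J where J: "J \<subseteq> S'" "card J = L"
        by (meson obtain_subset_with_card_n)
      then obtain T where T: "T \<subseteq> J" "insert i T \<in> H"
        using link[of i J] S' S_def by blast
      have "insert i T \<subseteq> S" using S' J T by auto
      then have "insert (insert i T) M \<in> \<M>"
        using T M dM by (auto simp: \<M>_def S_def pairwise_insert disjnt_def)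
      from max[OF this] have "insert i T \<in> M" by auto
      with \<open>insert i T \<subseteq> S\<close> show False by (auto simp: S_def)
    qed
    have "card (\<Union>M) = sum card M"
      using dM M(1) Hfin by (intro card_Union_disjoint) auto
    also have "\<dots> = (\<Sum>e\<in>M. t)"
      using M(1) H by (intro sum.cong) auto
    finally have cardUM: "card (\<Union>M) = t * card M" by simp
    have "\<Union>M \<subseteq> V" using M by auto
    then have cardV: "card V = t * card M + card S"
      using V cardUM card_Diff_subset[of "\<Union>M" V] card_mono[of V "\<Union>M"] finite_subset[of "\<Union>M" V]
      by (simp add: S_def)
    \<comment> \<open>Hence the label classes of the rematched edges, of size
      \<open>card S * (t - 1)\<close>, are divisible by \<open>t\<close>.\<close>
    then have dvdS: "t dvd card S" using dvd by (simp add: dvd_add_right_iff)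
    have "t * N2 \<le> t * card M" using cardV cardS m0 by linarith
    then have N2M: "N2 \<le> card M" using t by simp
    obtain q where q: "bij_betw q {..<card M} M"
      using finM bij_betw_from_nat_into_finite by blast
    have "\<forall>e\<in>M. \<exists>g. bij_betw g {..<t} e"
      using M(1) H Hfin by (metis bij_betw_from_nat_into_finite subsetD)
    then obtain g where g: "\<And>e. e \<in> M \<Longrightarrow> bij_betw (g e) {..<t} e" by metis
    \<comment> \<open>The vertex labelled \<open>c\<close> in the \<open>a\<close>-th matching edge.
      Ramsey's theorem is applied to the indices \<open>a\<close>, so that one index set serves all
      labels at once.\<close>
    define w where "w c a = g (q a) c" for c a
    have qM: "q a \<in> M" if "a < card M" for a
      using q that by (auto simp: bij_betw_def)
    have w_in: "w c a \<in> q a" if "c < t" "a < card M" for c a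
      using g[OF qM[OF that(2)]] that by (auto simp: bij_betw_def w_def)
    have w_V: "w c a \<in> V" if "c < t" "a < card M" for c a
      using w_in[OF that] qM[OF that(2)] M(2) by blast
    have w_inj2: "a = a'" if "w c a = w c' a'" "c < t" "c' < t" "a < card M" "a' < card M" for c c' a a'
    proof -
      have "q a = q a'"
        using w_in[of c a] w_in[of c' a'] that qM[of a] qM[of a'] dM
        by (metis disjnt_iff pairwiseD)
      then show ?thesis using q that by (auto simp: bij_betw_def inj_on_def)
    qed
    have w_inj1: "c = c'" if "w c a = w c' a" "c < t" "c' < t" "a < card M" for c c' a
      using g[OF qM[OF that(4)]] that by (auto simp: bij_betw_def inj_on_def w_def)
    have w_inj: "inj_on (w c) A" if "c < t" "A \<subseteq> {..<card M}" for c A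
      using that w_inj2[of c _ c] by (intro inj_onI) auto
    have w_card: "card (w c ` A) = card A" if "c < t" "A \<subseteq> {..<card M}" for c A
      using card_image[OF w_inj[OF that]] .
    have w_not_S: "w c a \<notin> S" if "c < t" "a < card M" for c a
      using w_in[OF that] qM[OF that(2)] by (auto simp: S_def)
    \<comment> \<open>Of any \<open>L + 1\<close> vertices labelled \<open>c\<close>, one forms an
      edge with \<open>t - 1\<close> of the other \<open>L\<close>; hence the parameter
      \<open>L + 1\<close> in \<open>N2\<close>.\<close>
    have "\<exists>A'\<subseteq>{..<card M}. card A' = N1 \<and> (\<forall>c\<in>{..<t}. \<forall>T\<subseteq>A'. card T = t \<longrightarrow> w c ` T \<in> H)"
    proof (rule N2, goal_cases)
      case 5
      show ?case
      proof (intro ballI allI impI)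
        fix c B assume c: "c \<in> {..<t}" and B: "B \<subseteq> {..<card M}" "card B = L + 1"
        then obtain b B' where B': "B = insert b B'" "b \<notin> B'" "card B' = L"
          by (metis Suc_eq_plus1 card_Suc_eq)
        have "w c b \<notin> w c ` B'"
          using w_inj[of c B] c B B' by auto
        then obtain T where T: "T \<subseteq> w c ` B'" "card T = t - 1" "insert (w c b) T \<in> H"
          using link[of "w c b" "w c ` B'"] w_V[of c] w_card[of c B'] c B B'
          by (auto simp: image_subset_iff)
        then obtain T' where T': "T' \<subseteq> B'" "T = w c ` T'"
          by (meson subset_imageE)
        have "w c ` insert b T' \<in> H" using T T' by simp
        moreover have "insert b T' \<subseteq> B" using T' B' by auto
        moreover from calculation have "card (insert b T') = t"
          using H w_card[of c "insert b T'"] c B(1) by (metis lessThan_iff subset_trans)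
        ultimately show "\<exists>T\<subseteq>B. card T = t \<and> w c ` T \<in> H" by blast
      qed
    qed (use N2M in auto)
    then obtain A2 where A2: "A2 \<subseteq> {..<card M}" "card A2 = N1"
      and A2H: "\<And>c T. c < t \<Longrightarrow> T \<subseteq> A2 \<Longrightarrow> card T = t \<Longrightarrow> w c ` T \<in> H"
      by blast
    \<comment> \<open>Only label 0 has to be compatible with \<open>S\<close>; the other labels are
      matched within themselves.\<close>
    have "\<exists>A'\<subseteq>A2. card A' = L * (t - 1) \<and>
        (\<forall>s\<in>S. \<forall>T\<subseteq>A'. card T = t - 1 \<longrightarrow> insert s (w 0 ` T) \<in> H)"
    proof (rule N1, goal_cases)
      case 5
      show ?case
      proof (intro ballI allI impI)
        fix s B assume s: "s \<in> S" and B: "B \<subseteq> A2" "card B = L"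
        have B2: "B \<subseteq> {..<card M}" using B A2 by auto
        have "s \<notin> w 0 ` B" using w_not_S[of 0] B2 t s by auto
        moreover have "w 0 ` B \<subseteq> V" using w_V[of 0] B2 t by auto
        moreover have "card (w 0 ` B) = L" using w_card[of 0 B] B B2 t by simp
        moreover have "s \<in> V" using s by (simp add: S_def)
        ultimately obtain T where T: "T \<subseteq> w 0 ` B" "card T = t - 1" "insert s T \<in> H"
          using link[of s "w 0 ` B"] by blast
        then obtain T' where T': "T' \<subseteq> B" "T = w 0 ` T'"
          by (meson subset_imageE)
        then have "card T' = t - 1"
          using T w_card[of 0 T'] t B2 by auto
        then show "\<exists>T\<subseteq>B. card T = t - 1 \<and> insert s (w 0 ` T) \<in> H"
          using T T' by blast
      qed
    qed (use A2 finS cardS in \<open>auto intro: finite_subset\<close>)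
    then obtain A3 where A3: "A3 \<subseteq> A2" "card A3 = L * (t - 1)"
      and A3H: "\<And>s T. s \<in> S \<Longrightarrow> T \<subseteq> A3 \<Longrightarrow> card T = t - 1 \<Longrightarrow> insert s (w 0 ` T) \<in> H"
      by blast
    have "card S * (t - 1) \<le> card A3" using A3 cardS by simp
    then obtain A where A: "A \<subseteq> A3" "card A = card S * (t - 1)" "finite A"
      by (metis obtain_subset_with_card_n)
    have AM: "A \<subseteq> {..<card M}" using A A2 A3 by auto
    have stars: "tileable H (S \<union> w 0 ` A)"
    proof (rule tileable_stars[where p = "t - 1"])
      show "S \<inter> w 0 ` A = {}" using w_not_S[of 0] AM t by auto
      show "card (w 0 ` A) = card S * (t - 1)" using w_card[of 0 A] AM A t by simp
      show "insert s T \<in> H" if sT: "s \<in> S" "T \<subseteq> w 0 ` A" "card T = t - 1" for s T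
      proof -
        obtain T' where T': "T' \<subseteq> A" "T = w 0 ` T'"
          using sT by (meson subset_imageE)
        then have "card T' = t - 1" using sT w_card[of 0 T'] t AM by auto
        then show ?thesis using A3H[of s T'] T' A sT by auto
      qed
    qed (use finS A in auto)
    have compl: "tileable H (\<Union>c\<in>{1..<t}. w c ` A)"
    proof (rule tileable_UN)
      fix c assume c: "c \<in> {1..<t}"
      show "tileable H (w c ` A)"
      proof (rule tileable_complete[where t = t])
        show "t dvd card (w c ` A)" using w_card[of c A] c AM A dvdS by simp
        fix T assume T: "T \<subseteq> w c ` A" "card T = t"
        then obtain T' where T': "T' \<subseteq> A" "T = w c ` T'"
          by (meson subset_imageE)
        then have "card T' = t" using T w_card[of c T'] c AM by auto
        then show "T \<in> H" using A2H[of c T'] T' A A3 c by auto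
      qed (use A in auto)
    next
      show "disjoint_family_on (\<lambda>c. w c ` A) {1..<t}"
        unfolding disjoint_family_on_def
      proof (intro ballI impI)
        fix c c' assume *: "c \<in> {1..<t}" "c' \<in> {1..<t}" "c \<noteq> c'"
        show "w c ` A \<inter> w c' ` A = {}"
        proof (rule ccontr)
          assume "w c ` A \<inter> w c' ` A \<noteq> {}"
          then obtain a a' where a: "a \<in> A" "a' \<in> A" "w c a = w c' a'" by auto
          then have "a = a'" using w_inj2[of c a c' a'] * AM by auto
          then show False using w_inj1[of c a c'] a * AM by auto
        qed
      qed
    qed auto
    have q_disj: "q a \<inter> q b = {}" if "a < card M" "b < card M" "a \<noteq> b" for a b
    proof -
      have "q a \<noteq> q b" using q that by (auto simp: bij_betw_def inj_on_def)
      then show ?thesis using that qM dM by (auto simp: pairwise_def disjnt_def)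
    qed
    \<comment> \<open>Matching edges with index outside \<open>A\<close> are kept.\<close>
    have rest: "tileable H (\<Union>a\<in>{..<card M} - A. q a)"
    proof (rule tileable_UN)
      show "disjoint_family_on q ({..<card M} - A)"
        using q_disj by (auto simp: disjoint_family_on_def)
    qed (use qM M(1) in \<open>auto intro!: tileable_single\<close>)
    have q_eq: "q a = (\<lambda>c. w c a) ` {..<t}" if "a < card M" for a
      using g[OF qM[OF that]] by (auto simp: bij_betw_def w_def)
    have disj1: "(S \<union> w 0 ` A) \<inter> (\<Union>c\<in>{1..<t}. w c ` A) = {}"
    proof -
      have False if a: "c \<in> {1..<t}" "a \<in> A" "b \<in> A" "w c a = w 0 b" for a b c
      proof -
        have "a = b" using w_inj2[of c a 0 b] a AM t by auto
        then show False using w_inj1[of c a 0] a AM t by auto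
      qed
      moreover have "w c a \<notin> S" if "c \<in> {1..<t}" "a \<in> A" for a c
        using w_not_S[of c a] that AM by auto
      ultimately show ?thesis by fastforce
    qed
    have disj2: "(\<Union>a\<in>{..<card M} - A. q a) \<inter> ((S \<union> w 0 ` A) \<union> (\<Union>c\<in>{1..<t}. w c ` A)) = {}"
    proof -
      have "w c a \<notin> q b" if "c < t" "a \<in> A" "b \<in> {..<card M} - A" for a b c
        using w_in[of c a] q_disj[of a b] that AM by auto
      moreover have "q b \<inter> S = {}" if "b < card M" for b
        using qM[OF that] by (auto simp: S_def)
      ultimately show ?thesis using t by fastforce
    qed
    have "V = (\<Union>a\<in>{..<card M} - A. q a) \<union> ((S \<union> w 0 ` A) \<union> (\<Union>c\<in>{1..<t}. w c ` A))" (is "_ = ?R")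
    proof
      show "?R \<subseteq> V"
        using w_V AM t qM M(2) by (fastforce simp: S_def)
      show "V \<subseteq> ?R"
      proof
        fix v assume v: "v \<in> V"
        show "v \<in> ?R"
        proof (cases "v \<in> S")
          case False
          then have "v \<in> \<Union>M" using v by (simp add: S_def)
          then obtain a where a: "a < card M" "v \<in> q a"
            using q by (auto simp: bij_betw_def)
          then obtain c where c: "c < t" "v = w c a" using q_eq by auto
          then show ?thesis using a by (cases "a \<in> A"; cases "c = 0") auto
        qed auto
      qed
    qed
    then show "tileable H V"
      using tileable_Un[OF rest tileable_Un[OF stars compl disj1] disj2] by simp
  qed
qed

subsection \<open>Cliques through a given part\<close>

text \<open>Induction on \<open>k\<close>, passing to the neighbourhood of a vertex of largest weighted degree.\<close>

lemma weighted_turan: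
  fixes \<mu> :: "'a \<Rightarrow> real"
  assumes "finite V" "\<And>u. u \<in> V \<Longrightarrow> 0 \<le> \<mu> u" "\<And>u v. E u v \<Longrightarrow> E v u" "\<And>u. \<not> E u u" "1 \<le> k"
    and "\<not> (\<exists>K\<subseteq>V. card K = Suc k \<and> (\<forall>u\<in>K. \<forall>v\<in>K. u \<noteq> v \<longrightarrow> E u v))"
  shows "(\<Sum>u\<in>V. \<Sum>v\<in>V. of_bool (E u v) * \<mu> u * \<mu> v) \<le> (1 - 1 / real k) * (\<Sum>u\<in>V. \<mu> u)\<^sup>2"
  using assms(5,1,2,6)
proof (induction k arbitrary: V rule: dec_induct)
  case base
  have "\<not> E u v" if "u \<in> V" "v \<in> V" for u v
  proof
    assume E: "E u v"
    then have "u \<noteq> v" using assms(4) by blast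
    then have "card {u, v} = Suc 1" by simp
    moreover have "\<forall>a\<in>{u,v}. \<forall>b\<in>{u,v}. a \<noteq> b \<longrightarrow> E a b" using E assms(3) by blast
    ultimately show False using base(3) that by (metis empty_subsetI insert_subset)
  qed
  then show ?case by simp
next
  case (step k)
  define D where "D u = (\<Sum>v\<in>V. of_bool (E u v) * \<mu> v)" for u
  define W where "W = (\<Sum>u\<in>V. \<mu> u)"
  show ?case
  proof (cases "V = {}")
    case False
    have "\<exists>x\<in>V. \<forall>u\<in>V. D u \<le> D x"
    proof -
      have "Max (D ` V) \<in> D ` V" using False step.prems(1) by (intro Max_in) auto
      then obtain x where "x \<in> V" "D x = Max (D ` V)" by auto
      then show ?thesis using step.prems(1) by (intro bexI[of _ x]) auto
    qed
    then obtain x where x: "x \<in> V" "\<And>u. u \<in> V \<Longrightarrow> D u \<le> D x" by blast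
    define N where "N = {v\<in>V. E x v}"
    have NV: "N \<subseteq> V" "finite N" using step.prems(1) by (auto simp: N_def)
    have DN: "D x = (\<Sum>v\<in>N. \<mu> v)"
      unfolding D_def N_def by (subst sum.inter_filter[OF step.prems(1)]) (intro sum.cong refl, auto)
    have IH: "(\<Sum>u\<in>N. \<Sum>v\<in>N. of_bool (E u v) * \<mu> u * \<mu> v) \<le> (1 - 1 / real k) * (D x)\<^sup>2"
      unfolding DN
    proof (rule step.IH)
      show "\<not> (\<exists>K\<subseteq>N. card K = Suc k \<and> (\<forall>u\<in>K. \<forall>v\<in>K. u \<noteq> v \<longrightarrow> E u v))"
      proof
        assume "\<exists>K\<subseteq>N. card K = Suc k \<and> (\<forall>u\<in>K. \<forall>v\<in>K. u \<noteq> v \<longrightarrow> E u v)"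
        then obtain K where K: "K \<subseteq> N" "card K = Suc k" "\<forall>u\<in>K. \<forall>v\<in>K. u \<noteq> v \<longrightarrow> E u v" by blast
        have "x \<notin> K" using K(1) assms(4) by (auto simp: N_def)
        then have "card (insert x K) = Suc (Suc k)" using K NV finite_subset[of K N] by simp
        moreover have "\<forall>u\<in>insert x K. \<forall>v\<in>insert x K. u \<noteq> v \<longrightarrow> E u v"
          using K assms(3) by (auto simp: N_def)
        moreover have "insert x K \<subseteq> V" using K(1) NV x by auto
        ultimately show False using step.prems(3) by blast
      qed
    qed (use NV step.prems(2) in auto)
    have Wsplit: "W = (\<Sum>u\<in>V - N. \<mu> u) + D x"
      unfolding W_def DN using NV step.prems(1) by (simp add: sum.subset_diff)
    have Dle: "(\<Sum>u\<in>V - N. \<mu> u * D u) \<le> (\<Sum>u\<in>V - N. \<mu> u) * D x"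
      unfolding sum_distrib_right using x(2) step.prems(2) by (intro sum_mono mult_left_mono) auto
    \<comment> \<open>Ordered pairs from \<open>N\<close> into \<open>V - N\<close> are bounded by
      the weighted degrees in \<open>V - N\<close>, as are the pairs starting in
      \<open>V - N\<close>; together they give the factor 2 below.\<close>
    have cross: "(\<Sum>u\<in>N. \<Sum>v\<in>V - N. of_bool (E u v) * \<mu> u * \<mu> v) \<le> (\<Sum>u\<in>V - N. \<mu> u * D u)"
    proof -
      have "(\<Sum>u\<in>N. \<Sum>v\<in>V - N. of_bool (E u v) * \<mu> u * \<mu> v)
          \<le> (\<Sum>u\<in>V. \<Sum>v\<in>V - N. of_bool (E u v) * \<mu> u * \<mu> v)"
        using NV step.prems(1,2) by (intro sum_mono2 sum_nonneg) auto
      also have "\<dots> = (\<Sum>v\<in>V - N. \<Sum>u\<in>V. of_bool (E u v) * \<mu> u * \<mu> v)"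
        by (rule sum.swap)
      also have "\<dots> = (\<Sum>v\<in>V - N. \<mu> v * D v)"
        unfolding D_def sum_distrib_left using assms(3) by (intro sum.cong refl) (auto simp: of_bool_def)
      finally show ?thesis .
    qed
    have "(\<Sum>u\<in>V. \<Sum>v\<in>V. of_bool (E u v) * \<mu> u * \<mu> v) = (\<Sum>u\<in>V. \<mu> u * D u)"
      unfolding D_def sum_distrib_left by (intro sum.cong refl) (simp add: ac_simps)
    also have "\<dots> = (\<Sum>u\<in>V - N. \<mu> u * D u) + (\<Sum>u\<in>N. \<mu> u * D u)"
      using NV step.prems(1) by (simp add: sum.subset_diff)
    also have "(\<Sum>u\<in>N. \<mu> u * D u) = (\<Sum>u\<in>N. \<Sum>v\<in>V. of_bool (E u v) * \<mu> u * \<mu> v)"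
      unfolding D_def sum_distrib_left by (intro sum.cong refl) (simp add: ac_simps)
    also have "\<dots> = (\<Sum>u\<in>N. \<Sum>v\<in>V - N. of_bool (E u v) * \<mu> u * \<mu> v)
        + (\<Sum>u\<in>N. \<Sum>v\<in>N. of_bool (E u v) * \<mu> u * \<mu> v)"
      using NV step.prems(1) by (simp add: sum.subset_diff[of N V] sum.distrib)
    finally have "(\<Sum>u\<in>V. \<Sum>v\<in>V. of_bool (E u v) * \<mu> u * \<mu> v)
        \<le> 2 * ((W - D x) * D x) + (1 - 1 / real k) * (D x)\<^sup>2"
      using cross Dle IH Wsplit by simp
    also have "\<dots> \<le> (1 - 1 / real (Suc k)) * W\<^sup>2"
    proof -
      have k: "real k > 0" using step.hyps by simp
      \<comment> \<open>Completing the square: as a quadratic in \<open>D x\<close> the bound is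
        largest at \<open>D x = k * W / (k + 1)\<close>, where it equals the right-hand
        side.\<close>
      have "(1 - 1 / real (Suc k)) * W\<^sup>2 - (2 * ((W - D x) * D x) + (1 - 1 / real k) * (D x)\<^sup>2)
        = (real k * W - (real k + 1) * D x)\<^sup>2 / (real k * (real k + 1))"
        using k by (simp add: field_simps power2_eq_square)
      moreover have "\<dots> \<ge> 0" using k by simp
      ultimately show ?thesis by linarith
    qed
    finally show ?thesis by (simp add: W_def)
  qed simp
qed

section \<open>Edge densities between parts\<close>

lemma edge_density_eq:
  assumes "finite X" "finite Y" "X \<inter> Y = {}"
  shows "edge_density G X Y =
    (\<Sum>x\<in>X. \<Sum>y\<in>Y. of_bool ({x, y} \<in> edges G)) / (real (card X) * real (card Y))"
proof -
  let ?R = "{z\<in>X \<times> Y. {fst z, snd z} \<in> edges G}"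
  have "edges_between G X Y = (\<lambda>z. {fst z, snd z}) ` ?R"
    by (force simp: edges_between_def image_iff)
  \<comment> \<open>As \<open>X\<close> and \<open>Y\<close> are disjoint, an edge determines its
    ordered pair.\<close>
  moreover have "inj_on (\<lambda>z. {fst z, snd z}) ?R"
    using assms(3) by (auto simp: inj_on_def doubleton_eq_iff)
  ultimately have "card (edges_between G X Y) = card ?R"
    by (simp add: card_image)
  also have "real \<dots> = (\<Sum>z\<in>X \<times> Y. of_bool ({fst z, snd z} \<in> edges G))"
    using assms by (simp add: of_bool_def sum.If_cases Int_def)
  also have "\<dots> = (\<Sum>x\<in>X. \<Sum>y\<in>Y. of_bool ({x, y} \<in> edges G))"
    by (simp add: sum.cartesian_product case_prod_beta)
  finally show ?thesis by (simp add: edge_density_def)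
qed

lemma edge_density_commute: "edge_density G X Y = edge_density G Y X"
proof -
  have "edges_between G X Y = edges_between G Y X"
    by (auto simp: edges_between_def insert_commute)
  then show ?thesis by (simp add: edge_density_def mult.commute)
qed

text \<open>\<open>2 \<le> m\<close> makes the minimum range over a nonempty set, and symmetry of
  the density removes the order on \<open>i\<close> and \<open>j\<close>.\<close>

lemma multipartite_density_ge_iff:
  assumes "2 \<le> m"
  shows "\<alpha> \<le> multipartite_density m G P \<longleftrightarrow>
    (\<forall>i<m. \<forall>j<m. i \<noteq> j \<longrightarrow> \<alpha> \<le> edge_density G (P i) (P j))"
proof -
  let ?D = "{edge_density G (P i) (P j) | i j. i < j \<and> j < m}"
  have "?D \<subseteq> (\<lambda>(i, j). edge_density G (P i) (P j)) ` ({..<m} \<times> {..<m})" by force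
  then have "finite ?D" by (rule finite_subset) simp
  moreover have "edge_density G (P 0) (P 1) \<in> ?D" using assms by force
  ultimately have "\<alpha> \<le> multipartite_density m G P \<longleftrightarrow> (\<forall>d\<in>?D. \<alpha> \<le> d)"
    unfolding multipartite_density_def by (intro Min_ge_iff) auto
  also have "\<dots> \<longleftrightarrow> (\<forall>i j. i < j \<and> j < m \<longrightarrow> \<alpha> \<le> edge_density G (P i) (P j))" by blast
  also have "\<dots> \<longleftrightarrow> (\<forall>i<m. \<forall>j<m. i \<noteq> j \<longrightarrow> \<alpha> \<le> edge_density G (P i) (P j))"
    by (metis edge_density_commute less_trans nat_neq_iff)
  finally show ?thesis .
qed

text \<open>The sets \<open>I\<close> with \<open>card I = t\<close> and this property are the edges
  of the auxiliary hypergraph on part indices that \<open>perfect_tiling\<close> is applied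
  to.\<close>

definition spans_clique :: "'a ugraph \<Rightarrow> (nat \<Rightarrow> 'a set) \<Rightarrow> nat set \<Rightarrow> bool" where
  "spans_clique G P I \<longleftrightarrow>
     (\<exists>g. (\<forall>a\<in>I. g a \<in> P a) \<and> (\<forall>a\<in>I. \<forall>b\<in>I. a \<noteq> b \<longrightarrow> {g a, g b} \<in> edges G))"

lemma multipartite_finite_part: "multipartite m G P \<Longrightarrow> i < m \<Longrightarrow> finite (P i)"
  unfolding multipartite_def simple_graph_def by (metis UN_upper finite_subset lessThan_iff)

text \<open>Averaging over part \<open>i\<close> yields a vertex whose mean fraction over
  \<open>J\<close> is at least \<open>\<alpha> + \<epsilon>\<close>. As no fraction exceeds 1, many
  of them must reach \<open>\<alpha>\<close>.\<close>

lemma vertex_rich_in_many_parts: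
  assumes G: "multipartite m G P" and "\<alpha> < 1" "0 < \<epsilon>"
    and dens: "\<And>j. j \<in> J \<Longrightarrow> \<alpha> + \<epsilon> \<le> edge_density G (P i) (P j)"
    and i: "i < m" and J: "J \<subseteq> {..<m} - {i}" and \<alpha>0: "0 < \<alpha>"
  shows "\<exists>v\<in>P i. \<epsilon> * real (card J)
    \<le> real (card {j\<in>J. \<alpha> * real (card (P j)) \<le> real (card {y\<in>P j. {v, y} \<in> edges G})})"
proof -
  have finP: "finite (P a)" if "a < m" for a
    using G that by (rule multipartite_finite_part)
  have P0: "P a \<noteq> {}" if "a < m" for a using G that by (simp add: multipartite_def)
  have finJ: "finite J" using J finite_subset by blast
  define x where "x v j = real (card {y\<in>P j. {v, y} \<in> edges G}) / real (card (P j))" for v j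
  have x_le: "x v j \<le> 1" if "j < m" for v j
    using finP[OF that] by (auto simp: x_def intro!: divide_le_eq_1[THEN iffD2] card_mono)
  have x_eq: "x v j = (\<Sum>y\<in>P j. of_bool ({v, y} \<in> edges G)) / real (card (P j))" if "j < m" for v j
    using finP[OF that] by (simp add: x_def of_bool_def sum.If_cases Int_def)
  have "real (card (P i)) * (real (card J) * (\<alpha> + \<epsilon>)) = (\<Sum>j\<in>J. real (card (P i)) * (\<alpha> + \<epsilon>))"
    by simp
  also have "\<dots> \<le> (\<Sum>j\<in>J. \<Sum>v\<in>P i. x v j)"
  proof (rule sum_mono)
    fix j assume j: "j \<in> J"
    then have jm: "j < m" "j \<noteq> i" using J by auto
    have "real (card (P i)) * (\<alpha> + \<epsilon>) \<le> real (card (P i)) * edge_density G (P i) (P j)"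
      using dens[OF j] by (intro mult_left_mono) auto
    also have "\<dots> = (\<Sum>v\<in>P i. x v j)"
    proof -
      have "P i \<inter> P j = {}" using G jm i by (auto simp: multipartite_def)
      then show ?thesis
        using finP i jm P0 by (simp add: edge_density_eq x_eq sum_divide_distrib[symmetric])
    qed
    finally show "real (card (P i)) * (\<alpha> + \<epsilon>) \<le> (\<Sum>v\<in>P i. x v j)" .
  qed
  also have "\<dots> = (\<Sum>v\<in>P i. \<Sum>j\<in>J. x v j)" by (rule sum.swap)
  finally have avg: "real (card (P i)) * (real (card J) * (\<alpha> + \<epsilon>)) \<le> (\<Sum>v\<in>P i. \<Sum>j\<in>J. x v j)" .
  have "\<exists>v\<in>P i. real (card J) * (\<alpha> + \<epsilon>) \<le> (\<Sum>j\<in>J. x v j)"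
  proof (rule ccontr)
    assume "\<not> ?thesis"
    then have "(\<Sum>v\<in>P i. \<Sum>j\<in>J. x v j) < (\<Sum>v\<in>P i. real (card J) * (\<alpha> + \<epsilon>))"
      using finP[OF i] P0[OF i] by (intro sum_strict_mono) (auto simp: not_le)
    with avg show False by simp
  qed
  then obtain v where v: "v \<in> P i" "real (card J) * (\<alpha> + \<epsilon>) \<le> (\<Sum>j\<in>J. x v j)" by blast
  define J' where "J' = {j\<in>J. \<alpha> \<le> x v j}"
  have J': "J' \<subseteq> J" "finite J'" using finJ by (auto simp: J'_def)
  have "(\<Sum>j\<in>J. x v j) = (\<Sum>j\<in>J - J'. x v j) + (\<Sum>j\<in>J'. x v j)"
    using finJ J' by (simp add: sum.subset_diff)
  \<comment> \<open>Fractions are below \<open>\<alpha>\<close> outside \<open>J'\<close> and at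
    most 1 inside.\<close>
  also have "\<dots> \<le> (\<Sum>j\<in>J - J'. \<alpha>) + (\<Sum>j\<in>J'. 1)"
    using x_le J J' by (intro add_mono sum_mono) (auto simp: J'_def)
  also have "\<dots> = (real (card J) - real (card J')) * \<alpha> + real (card J')"
    using J' finJ by (simp add: card_Diff_subset of_nat_diff card_mono)
  finally have "real (card J) * \<epsilon> \<le> real (card J') * (1 - \<alpha>)"
    using v(2) by (simp add: algebra_simps)
  also have "\<dots> \<le> real (card J')" using \<alpha>0 by (simp add: mult_left_le)
  finally have "\<epsilon> * real (card J) \<le> real (card J')" by (simp add: mult.commute)
  moreover have "J' = {j\<in>J. \<alpha> * real (card (P j)) \<le> real (card {y\<in>P j. {v, y} \<in> edges G})}"
    using P0 finP J by (auto simp: J'_def x_def field_simps card_gt_0_iff)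
  ultimately show ?thesis using v(1) by auto
qed

text \<open>The quadratic for \<open>\<alpha>\<close> is exactly what turns a missing density of at
  most \<open>1 - \<alpha> - \<epsilon>\<close> between parts into one of at most
  \<open>1 / (t - 2) - \<epsilon>\<close> between neighbourhoods that fill a fraction
  \<open>\<alpha>\<close> of their parts. The bound on \<open>card J\<close> makes the excess
  \<open>\<epsilon>\<close> outweigh the absence of edges inside parts.\<close>

lemma clique_through_part:
  assumes G: "multipartite m G P" and t: "3 \<le> t"
    and \<alpha>: "0 < \<alpha>" "\<alpha> < 1" "1 - \<alpha> = \<alpha>\<^sup>2 / (real t - 2)" and \<epsilon>: "0 < \<epsilon>"
    and dens: "\<And>i j. i < m \<Longrightarrow> j < m \<Longrightarrow> i \<noteq> j \<Longrightarrow> \<alpha> + \<epsilon> \<le> edge_density G (P i) (P j)"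
    and i: "i < m" and J: "J \<subseteq> {..<m} - {i}" and large: "1 + 1 / \<epsilon> \<le> \<epsilon> * real (card J)"
  shows "\<exists>T\<subseteq>J. card T = t - 1 \<and> spans_clique G P (insert i T)"
proof -
  define E where "E u v \<longleftrightarrow> {u, v} \<in> edges G" for u v
  have Esym: "E u v \<Longrightarrow> E v u" for u v by (simp add: E_def insert_commute)
  have Eirr: "\<not> E u u" for u using G by (auto simp: E_def multipartite_def simple_graph_def)
  have finP: "finite (P a)" if "a < m" for a
    using G that by (rule multipartite_finite_part)
  have P0: "P a \<noteq> {}" if "a < m" for a using G that by (simp add: multipartite_def)
  have Pdisj: "P a \<inter> P b = {}" if "a < m" "b < m" "a \<noteq> b" for a b
    using G that by (simp add: multipartite_def)
  have Epart: "\<not> E u v" if "u \<in> P a" "v \<in> P a" "a < m" for u v a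
    using G that by (auto simp: E_def multipartite_def)
  have "\<exists>v\<in>P i. \<epsilon> * real (card J)
    \<le> real (card {j\<in>J. \<alpha> * real (card (P j)) \<le> real (card {y\<in>P j. {v, y} \<in> edges G})})"
    using J dens i by (intro vertex_rich_in_many_parts[OF G \<alpha>(2) \<epsilon> _ i J \<alpha>(1)]) auto
  then obtain v where v: "v \<in> P i" and rich: "\<epsilon> * real (card J)
    \<le> real (card {j\<in>J. \<alpha> * real (card (P j)) \<le> real (card {y\<in>P j. E v y})})"
    unfolding E_def by blast
  define N where "N j = {y\<in>P j. E v y}" for j
  define J' where "J' = {j\<in>J. \<alpha> * real (card (P j)) \<le> real (card (N j))}"
  define n where "n = real (card J')"
  have finJ': "finite J'" and J'J: "J' \<subseteq> J" using finite_subset[of J "{..<m} - {i}"] J by (auto simp: J'_def)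
  have J'm: "a < m" if "a \<in> J'" for a using that J'J J by auto
  have n: "1 + 1 / \<epsilon> \<le> n" using rich large by (simp add: n_def J'_def N_def)
  have NP: "N j \<subseteq> P j" for j by (auto simp: N_def)
  have finN: "finite (N j)" if "j \<in> J'" for j
    using finite_subset[OF NP finP] J'm that by blast
  have rich_N: "\<alpha> * real (card (P j)) \<le> real (card (N j))" if "j \<in> J'" for j
    using that by (simp add: J'_def)
  have posP: "0 < real (card (P j))" if "j \<in> J'" for j
    using finP P0 J'm[OF that] by (simp add: card_gt_0_iff)
  have posN: "0 < real (card (N j))" if "j \<in> J'" for j
    using rich_N[OF that] posP[OF that] \<alpha>(1) by (meson less_le_trans mult_pos_pos)
  define part where "part u = (SOME j. j < m \<and> u \<in> P j)" for u
  have part: "part u = j" if "j < m" "u \<in> P j" for u j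
  proof -
    have "part u < m \<and> u \<in> P (part u)"
      unfolding part_def by (rule someI[of _ j]) (use that in simp)
    then show ?thesis using that Pdisj[of "part u" j] by auto
  qed
  \<comment> \<open>Each neighbourhood \<open>N j\<close> with \<open>j \<in> J'\<close> gets total
    weight 1, whatever its size.\<close>
  define \<mu> where "\<mu> u = 1 / real (card (N (part u)))" for u
  have \<mu>: "\<mu> u = 1 / real (card (N j))" if "j \<in> J'" "u \<in> N j" for u j
    using part[of j u] J'm that NP by (auto simp: \<mu>_def)
  define U where "U = (\<Union>j\<in>J'. N j)"
  have finU: "finite U" using finJ' finN by (simp add: U_def)
  have sumU: "(\<Sum>u\<in>U. f u) = (\<Sum>j\<in>J'. \<Sum>u\<in>N j. f u)" for f :: "_ \<Rightarrow> real"
    unfolding U_def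
  proof (rule sum.UNION_disjoint)
    show "\<forall>a\<in>J'. \<forall>b\<in>J'. a \<noteq> b \<longrightarrow> N a \<inter> N b = {}"
      using NP Pdisj J'm by blast
  qed (use finJ' finN in auto)
  have total: "(\<Sum>u\<in>U. \<mu> u) = n"
  proof -
    have "(\<Sum>u\<in>N j. \<mu> u) = 1" if "j \<in> J'" for j
      using \<mu>[OF that] posN[OF that] by simp
    then show ?thesis by (simp add: sumU n_def)
  qed
  define k where "k = t - 2"
  have k: "1 \<le> k" "real k = real t - 2" using t by (auto simp: k_def of_nat_diff)
  have pair: "1 - 1 / real k + \<epsilon> \<le> (\<Sum>u\<in>N a. \<Sum>w\<in>N b. of_bool (E u w) * \<mu> u * \<mu> w)"
    if a: "a \<in> J'" and b: "b \<in> J'" and ab: "a \<noteq> b" for a b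
  proof -
    let ?e = "\<lambda>X Y. (\<Sum>u\<in>X. \<Sum>w\<in>Y. of_bool (E u w)) :: real"
    \<comment> \<open>Non-edges are counted because their number can only drop when parts are
      replaced by subsets.\<close>
    let ?f = "\<lambda>X Y. (\<Sum>u\<in>X. \<Sum>w\<in>Y. 1 - of_bool (E u w)) :: real"
    have f: "?f X Y = real (card X) * real (card Y) - ?e X Y" for X Y
      by (simp add: sum_subtractf)
    have "?f (N a) (N b) \<le> ?f (N a) (P b)"
      using NP[of b] finP[OF J'm[OF b]] by (intro sum_mono sum_mono2) auto
    also have "\<dots> \<le> ?f (P a) (P b)"
      using NP[of a] finP[OF J'm[OF a]] by (intro sum_mono2 sum_nonneg) auto
    finally have mono: "?f (N a) (N b) \<le> ?f (P a) (P b)" .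
    have "\<alpha> + \<epsilon> \<le> ?e (P a) (P b) / (real (card (P a)) * real (card (P b)))"
      using dens[OF J'm[OF a] J'm[OF b] ab] J'm a b ab finP Pdisj
      by (simp add: edge_density_eq E_def)
    then have "(\<alpha> + \<epsilon>) * (real (card (P a)) * real (card (P b))) \<le> ?e (P a) (P b)"
      using posP[OF a] posP[OF b] by (simp add: pos_le_divide_eq)
    then have fP: "?f (P a) (P b) \<le> (1 - \<alpha> - \<epsilon>) * (real (card (P a)) * real (card (P b)))"
      unfolding f by (simp add: algebra_simps)
    moreover have "0 \<le> ?f (P a) (P b)" by (intro sum_nonneg) auto
    ultimately have "0 \<le> (1 - \<alpha> - \<epsilon>) * (real (card (P a)) * real (card (P b)))" by linarith
    \<comment> \<open>This sign allows multiplying the upper bound on the product of part sizes by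
      \<open>1 - \<alpha> - \<epsilon>\<close>.\<close>
    then have nn: "0 \<le> 1 - \<alpha> - \<epsilon>"
      using mult_pos_pos[OF posP[OF a] posP[OF b]] by (meson not_le zero_le_mult_iff)
    let ?NN = "real (card (N a)) * real (card (N b))"
    have "\<alpha>\<^sup>2 * (real (card (P a)) * real (card (P b))) \<le> ?NN"
      using mult_mono[OF rich_N[OF a] rich_N[OF b]] \<alpha>(1) by (simp add: power2_eq_square algebra_simps)
    then have "real (card (P a)) * real (card (P b)) \<le> ?NN / \<alpha>\<^sup>2"
      using \<alpha>(1) by (simp add: pos_le_divide_eq mult.commute)
    then have "?f (N a) (N b) \<le> (1 - \<alpha> - \<epsilon>) * (?NN / \<alpha>\<^sup>2)"
      using mono fP nn by (meson mult_left_mono order_trans)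
    \<comment> \<open>Here the quadratic equation for \<open>\<alpha>\<close> enters.\<close>
    also have "\<dots> = (1 / real k - \<epsilon> / \<alpha>\<^sup>2) * ?NN"
    proof -
      have "1 - \<alpha> - \<epsilon> = \<alpha>\<^sup>2 / real k - \<epsilon>" using \<alpha>(3) k by simp
      then have "(1 - \<alpha> - \<epsilon>) / \<alpha>\<^sup>2 = 1 / real k - \<epsilon> / \<alpha>\<^sup>2"
        using \<alpha>(1) by (simp add: diff_divide_distrib)
      then show ?thesis by (metis times_divide_eq_left times_divide_eq_right)
    qed
    also have "\<dots> \<le> (1 / real k - \<epsilon>) * ?NN"
    proof -
      have "\<alpha>\<^sup>2 \<le> 1" using \<alpha> by (simp add: power_le_one)
      then have "\<epsilon> \<le> \<epsilon> / \<alpha>\<^sup>2" using \<epsilon> \<alpha>(1) by (simp add: pos_le_divide_eq mult_left_le)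
      then show ?thesis by (intro mult_right_mono) auto
    qed
    finally have "(1 - 1 / real k + \<epsilon>) * ?NN \<le> ?e (N a) (N b)"
      unfolding f by (simp add: algebra_simps)
    then have "1 - 1 / real k + \<epsilon> \<le> ?e (N a) (N b) / ?NN"
      using posN[OF a] posN[OF b] by (simp add: pos_le_divide_eq)
    also have "\<dots> = (\<Sum>u\<in>N a. \<Sum>w\<in>N b. of_bool (E u w) * \<mu> u * \<mu> w)"
      unfolding sum_divide_distrib using \<mu>[OF a] \<mu>[OF b] by (intro sum.cong refl) simp
    finally show ?thesis .
  qed
  have "n * (n - 1) * (1 - 1 / real k + \<epsilon>) = (\<Sum>a\<in>J'. \<Sum>b\<in>J' - {a}. 1 - 1 / real k + \<epsilon>)"
  proof -
    have "(\<Sum>b\<in>J' - {a}. 1 - 1 / real k + \<epsilon>) = (n - 1) * (1 - 1 / real k + \<epsilon>)" if "a \<in> J'" for a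
    proof -
      have "Suc (card (J' - {a})) = card J'" using card_Suc_Diff1[OF finJ' that] .
      then have "real (card (J' - {a})) = n - 1" unfolding n_def by linarith
      then show ?thesis by simp
    qed
    then have "(\<Sum>a\<in>J'. \<Sum>b\<in>J' - {a}. 1 - 1 / real k + \<epsilon>)
        = (\<Sum>a\<in>J'. (n - 1) * (1 - 1 / real k + \<epsilon>))"
      by (rule sum.cong[OF refl])
    also have "\<dots> = n * (n - 1) * (1 - 1 / real k + \<epsilon>)"
      by (simp add: n_def)
    finally show ?thesis by (rule sym)
  qed
  also have "\<dots> \<le> (\<Sum>a\<in>J'. \<Sum>b\<in>J'. \<Sum>u\<in>N a. \<Sum>w\<in>N b. of_bool (E u w) * \<mu> u * \<mu> w)"
  proof (rule sum_mono)
    fix a assume a: "a \<in> J'"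
    have "(\<Sum>b\<in>J' - {a}. 1 - 1 / real k + \<epsilon>)
        \<le> (\<Sum>b\<in>J' - {a}. \<Sum>u\<in>N a. \<Sum>w\<in>N b. of_bool (E u w) * \<mu> u * \<mu> w)"
      using pair a by (intro sum_mono) auto
    also have "\<dots> \<le> (\<Sum>b\<in>J'. \<Sum>u\<in>N a. \<Sum>w\<in>N b. of_bool (E u w) * \<mu> u * \<mu> w)"
      using finJ' by (intro sum_mono2 sum_nonneg) (auto simp: \<mu>_def)
    finally show "(\<Sum>b\<in>J' - {a}. 1 - 1 / real k + \<epsilon>)
      \<le> (\<Sum>b\<in>J'. \<Sum>u\<in>N a. \<Sum>w\<in>N b. of_bool (E u w) * \<mu> u * \<mu> w)" .
  qed
  also have "\<dots> = (\<Sum>a\<in>J'. \<Sum>u\<in>N a. \<Sum>b\<in>J'. \<Sum>w\<in>N b. of_bool (E u w) * \<mu> u * \<mu> w)"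
    by (intro sum.cong refl sum.swap)
  also have "\<dots> = (\<Sum>u\<in>U. \<Sum>w\<in>U. of_bool (E u w) * \<mu> u * \<mu> w)"
    by (simp add: sumU)
  finally have lower: "n * (n - 1) * (1 - 1 / real k + \<epsilon>) \<le> (\<Sum>u\<in>U. \<Sum>w\<in>U. of_bool (E u w) * \<mu> u * \<mu> w)" .
  have npos: "0 < n" using n divide_pos_pos[OF zero_less_one \<epsilon>] by linarith
  \<comment> \<open>Only \<open>n * (n - 1)\<close> of the \<open>n * n\<close> ordered pairs of
    neighbourhoods contribute; the loss \<open>1 - 1 / k\<close> is covered by
    \<open>(n - 1) * \<epsilon> \<ge> 1\<close>.\<close>
  have "n * (1 - 1 / real k) < (n - 1) * (1 - 1 / real k + \<epsilon>)"
  proof -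
    have a: "1 \<le> (n - 1) * \<epsilon>" using n \<epsilon> by (simp add: field_simps)
    have b: "0 < 1 / real k" using k by simp
    have "(n - 1) * (1 - c + \<epsilon>) - n * (1 - c) = (n - 1) * \<epsilon> - 1 + c" for c
      by (simp add: algebra_simps)
    from this[of "1 / real k"] a b show ?thesis by linarith
  qed
  from mult_strict_left_mono[OF this npos]
  have "(1 - 1 / real k) * n\<^sup>2 < n * (n - 1) * (1 - 1 / real k + \<epsilon>)"
    by (simp only: power2_eq_square ac_simps)
  with lower have gt: "(1 - 1 / real k) * (\<Sum>u\<in>U. \<mu> u)\<^sup>2 < (\<Sum>u\<in>U. \<Sum>w\<in>U. of_bool (E u w) * \<mu> u * \<mu> w)"
    by (simp add: total)
  have "\<exists>K\<subseteq>U. card K = Suc k \<and> (\<forall>u\<in>K. \<forall>w\<in>K. u \<noteq> w \<longrightarrow> E u w)"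
  proof (rule ccontr)
    assume "\<not> ?thesis"
    then have "(\<Sum>u\<in>U. \<Sum>w\<in>U. of_bool (E u w) * \<mu> u * \<mu> w) \<le> (1 - 1 / real k) * (\<Sum>u\<in>U. \<mu> u)\<^sup>2"
      by (intro weighted_turan[OF finU _ Esym Eirr k(1)]) (auto simp: \<mu>_def)
    with gt show False by simp
  qed
  then obtain K where K: "K \<subseteq> U" "card K = Suc k" "\<And>u w. u \<in> K \<Longrightarrow> w \<in> K \<Longrightarrow> u \<noteq> w \<Longrightarrow> E u w"
    by blast
  have Kpart: "part u \<in> J' \<and> u \<in> N (part u)" if "u \<in> K" for u
  proof -
    obtain j where j: "j \<in> J'" "u \<in> N j" using K(1) \<open>u \<in> K\<close> unfolding U_def by blast
    then show ?thesis using part[of j u] J'm NP by auto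
  qed
  \<comment> \<open>Adjacent vertices lie in different parts.\<close>
  have inj: "inj_on part K"
    using Kpart K(3) NP J'm Epart by (intro inj_onI) (metis subsetD)
  define g where "g j = (if j = i then v else inv_into K part j)" for j
  have g: "g (part u) = u" if "u \<in> K" for u
    using Kpart[OF that] J'J J inv_into_f_f[OF inj that] by (auto simp: g_def)
  have gi: "g i = v" by (simp add: g_def)
  have "spans_clique G P (insert i (part ` K))"
    unfolding spans_clique_def E_def[symmetric]
  proof (intro exI[of _ g] conjI ballI impI)
    fix a assume "a \<in> insert i (part ` K)"
    moreover have "u \<in> P (part u)" if "u \<in> K" for u using Kpart[OF that] NP by blast
    ultimately show "g a \<in> P a" using g gi v by auto
  next
    fix a b assume *: "a \<in> insert i (part ` K)" "b \<in> insert i (part ` K)" "a \<noteq> b"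
    have "E v u" if "u \<in> K" for u using Kpart[OF that] by (auto simp: N_def)
    moreover from this have "E u v" if "u \<in> K" for u using that Esym by blast
    moreover have "E u w" if "u \<in> K" "w \<in> K" "part u \<noteq> part w" for u w
      using K(3) that by blast
    ultimately show "E (g a) (g b)" using * g gi by auto
  qed
  moreover have "part ` K \<subseteq> J" using Kpart J'J by auto
  moreover have "card (part ` K) = t - 1" using card_image[OF inj] K(2) t by (simp add: k_def)
  ultimately show ?thesis by blast
qed

subsection \<open>Traversals\<close>

text \<open>Each tile is a set of \<open>t\<close> parts hosting one copy of \<open>K_t\<close>;
  since the tiles partition all parts, the copies together use every part once.\<close>

lemma contains_traversal_if_tileable:
  assumes G: "multipartite (r * t) G P" and t: "1 \<le> t"
    and tile: "tileable {I. card I = t \<and> spans_clique G P I} {..<r * t}"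
  shows "contains_traversal (r * t) G P (copies_complete r t)"
proof -
  obtain M where M: "\<And>e. e \<in> M \<Longrightarrow> card e = t" "\<And>e. e \<in> M \<Longrightarrow> spans_clique G P e"
    and finM: "finite M" and dM: "disjoint M" and UM: "\<Union>M = {..<r * t}"
    using tile unfolding tileable_def by blast
  have fin: "finite e" if "e \<in> M" for e using M(1)[OF that] t by (metis card.infinite not_one_le_zero)
  have "card (\<Union>M) = sum card M" using dM fin by (intro card_Union_disjoint)
  then have "r * t = card M * t" using M(1) by (simp add: UM)
  then have "card M = r" using t by simp
  then obtain q where q: "bij_betw q {..<r} M"
    using finM bij_betw_from_nat_into_finite by blast
  have qM: "q i \<in> M" if "i < r" for i using q that by (auto simp: bij_betw_def)
  have "\<forall>e\<in>M. \<exists>h. bij_betw h {..<t} e"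
    using M(1) fin by (metis bij_betw_from_nat_into_finite)
  then obtain h where h: "\<And>e. e \<in> M \<Longrightarrow> bij_betw (h e) {..<t} e" by metis
  obtain g where g: "\<And>e a. e \<in> M \<Longrightarrow> a \<in> e \<Longrightarrow> g e a \<in> P a"
      "\<And>e a b. e \<in> M \<Longrightarrow> a \<in> e \<Longrightarrow> b \<in> e \<Longrightarrow> a \<noteq> b \<Longrightarrow> {g e a, g e b} \<in> edges G"
    using M(2) unfolding spans_clique_def by metis
  let ?I = "{..<r} \<times> {..<t}"
  \<comment> \<open>\<open>\<phi> z\<close> is the part assigned to the vertex \<open>z\<close> of
    \<open>copies_complete r t\<close>, and \<open>f z\<close> is the vertex chosen there.\<close>
  define \<phi> where "\<phi> z = h (q (fst z)) (snd z)" for z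
  define f where "f z = g (q (fst z)) (\<phi> z)" for z
  have \<phi>_in: "\<phi> z \<in> q (fst z)" if "z \<in> ?I" for z
    using bij_betwE[OF h[OF qM[of "fst z"]]] that by (auto simp: \<phi>_def)
  have \<phi>_less: "\<phi> z < r * t" if "z \<in> ?I" for z
    using \<phi>_in[OF that] qM[of "fst z"] that UM by auto
  have \<phi>_inj: "inj_on \<phi> ?I"
  proof (rule inj_onI)
    fix z z' assume z: "z \<in> ?I" "z' \<in> ?I" "\<phi> z = \<phi> z'"
    have "q (fst z) = q (fst z')"
      using \<phi>_in[OF z(1)] \<phi>_in[OF z(2)] z qM dM
      by (metis disjnt_iff pairwiseD lessThan_iff mem_Times_iff)
    then have "fst z = fst z'"
      using q z by (auto simp: bij_betw_def inj_on_def)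
    moreover from this have "snd z = snd z'"
      using h[OF qM[of "fst z"]] z by (auto simp: \<phi>_def bij_betw_def inj_on_def)
    ultimately show "z = z'" by (simp add: prod_eq_iff)
  qed
  have fP: "f z \<in> P (\<phi> z)" if "z \<in> ?I" for z
    using g(1)[OF qM[of "fst z"] \<phi>_in[OF that]] that by (auto simp: f_def)
  have Pdisj: "a = b" if "x \<in> P a" "x \<in> P b" "a < r * t" "b < r * t" for a b x
    using G that unfolding multipartite_def by blast
  have f_part: "\<phi> z = a" if "z \<in> ?I" "a < r * t" "f z \<in> P a" for z a
    using Pdisj[OF fP[OF that(1)] that(3) \<phi>_less[OF that(1)] that(2)] .
  have f_inj: "inj_on f ?I"
  proof (rule inj_onI)
    fix z z' assume z: "z \<in> ?I" "z' \<in> ?I" "f z = f z'"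
    have "\<phi> z = \<phi> z'" using f_part[OF z(1) \<phi>_less[OF z(2)]] fP[OF z(2)] z(3) by simp
    then show "z = z'" using inj_onD[OF \<phi>_inj] z(1,2) by blast
  qed
  have \<phi>_surj: "\<phi> ` ?I = {..<r * t}"
    using \<phi>_less card_image[OF \<phi>_inj] by (intro card_subset_eq) auto
  \<comment> \<open>The induced subgraph on the chosen vertices serves as the traversal.\<close>
  define H where "H = \<lparr>verts = f ` ?I, edges = {e \<in> edges G. e \<subseteq> f ` ?I}\<rparr>"
  have "f ` ?I \<subseteq> verts G"
    using fP \<phi>_less G unfolding multipartite_def by blast
  then have sub: "subgraph H G"
    using G by (auto simp: subgraph_def H_def simple_graph_def multipartite_def)
  have one: "card (f ` ?I \<inter> P a) = 1" if a: "a < r * t" for a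
  proof -
    obtain z where z: "z \<in> ?I" "\<phi> z = a" using \<phi>_surj a by (metis imageE lessThan_iff)
    have "y = f z" if y: "y \<in> f ` ?I" "y \<in> P a" for y
    proof -
      obtain z' where z': "z' \<in> ?I" "y = f z'" using y(1) by blast
      then have "\<phi> z' = \<phi> z" using f_part[OF z'(1) a] y(2) z(2) by simp
      then show ?thesis using inj_onD[OF \<phi>_inj _ z'(1) z(1)] z'(2) by blast
    qed
    moreover have "f z \<in> P a" using fP[OF z(1)] z(2) by simp
    ultimately have "f ` ?I \<inter> P a = {f z}" using z(1) by blast
    then show ?thesis by simp
  qed
  have trav: "traversal (r * t) G P H"
    unfolding traversal_def using sub one card_image[OF f_inj] by (simp add: H_def)
  have "f ` e \<in> edges H" if "e \<in> edges (copies_complete r t)" for e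
  proof -
    obtain i a b where e: "e = {(i, a), (i, b)}" "i < r" "a < t" "b < t" "a \<noteq> b"
      using \<open>e \<in> _\<close> by (auto simp: copies_complete_def)
    have "\<phi> (i, a) \<noteq> \<phi> (i, b)" using e \<phi>_inj by (auto dest: inj_onD)
    then have "{f (i, a), f (i, b)} \<in> edges G"
      using e g(2)[OF qM[of i], of "\<phi> (i, a)" "\<phi> (i, b)"] \<phi>_in[of "(i, a)"] \<phi>_in[of "(i, b)"]
      by (simp add: f_def)
    then show ?thesis using e by (auto simp: H_def)
  qed
  then have "contains_copy H (copies_complete r t)"
    unfolding contains_copy_def using f_inj
    by (intro exI[of _ f]) (auto simp: H_def copies_complete_def)
  then show ?thesis using trav by (auto simp: contains_traversal_def)
qed

section \<open>The extremal construction: a part that no \<open>K_t\<close> meets\<close>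

lemma no_traversal_if_part_avoids_cliques:
  assumes "multipartite (r * t) G P" "1 \<le> r" "1 \<le> t"
    and avoid: "\<And>g :: nat \<Rightarrow> 'a. (\<And>a b. a < t \<Longrightarrow> b < t \<Longrightarrow> a \<noteq> b \<Longrightarrow> {g a, g b} \<in> edges G) \<Longrightarrow>
      \<forall>a<t. g a \<notin> P 0"
  shows "\<not> contains_traversal (r * t) G P (copies_complete r t)"
proof
  assume "contains_traversal (r * t) G P (copies_complete r t)"
  then obtain H f where sub: "subgraph H G" and cardH: "card (verts H) = r * t"
    and one: "\<forall>i<r * t. card (verts H \<inter> P i) = 1"
    and f: "inj_on f ({..<r} \<times> {..<t})" "f ` ({..<r} \<times> {..<t}) \<subseteq> verts H"
    and fE: "\<forall>e\<in>edges (copies_complete r t). f ` e \<in> edges H"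
    unfolding contains_traversal_def traversal_def contains_copy_def
    by (auto simp: copies_complete_def)
  \<comment> \<open>Both sides have \<open>r * t\<close> vertices, so the copy spans the traversal
    and one of its cliques contains the vertex in part 0.\<close>
  have eq: "f ` ({..<r} \<times> {..<t}) = verts H"
    using sub f(2) cardH card_image[OF f(1)]
    by (intro card_subset_eq) (auto simp: subgraph_def simple_graph_def)
  have "card (verts H \<inter> P 0) = 1" using one assms(2,3) by simp
  then obtain v where "v \<in> verts H" "v \<in> P 0"
    by (metis IntE card_1_singletonE singletonI)
  then obtain i a where ia: "i < r" "a < t" "f (i, a) \<in> P 0" unfolding eq[symmetric] by auto
  have "{f (i, b), f (i, c)} \<in> edges G" if "b < t" "c < t" "b \<noteq> c" for b c
  proof -
    have "{(i, b), (i, c)} \<in> edges (copies_complete r t)"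
      using that ia by (auto simp: copies_complete_def)
    then have "f ` {(i, b), (i, c)} \<in> edges H" using fE by blast
    then show ?thesis using sub by (auto simp: subgraph_def)
  qed
  from avoid[of "\<lambda>b. f (i, b)", OF this] ia show False by blast
qed

text \<open>Vertex \<open>u\<close> sits in part \<open>u div N\<close> at position \<open>u mod N\<close>. The first \<open>k s\<close> positions of each part
  are split into \<open>k = t - 2\<close> classes of size \<open>s\<close>, between which the parts other than part \<open>0\<close> form a
  \<open>k\<close>-partite Turan graph; the vertices of part \<open>0\<close> see exactly these positions, so they lie in no
  \<open>K\<^sub>t\<close>.\<close>

lemma traversal_free_construction:
  fixes r t N s :: nat
  assumes t: "3 \<le> t" and r: "1 \<le> r" and N: "0 < N" and s: "0 < s" and le: "(t - 2) * s \<le> N"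
  defines "x \<equiv> real ((t - 2) * s) / real N"
  shows "\<exists>(G :: nat ugraph) P. multipartite (r * t) G P \<and>
    (\<forall>i<r * t. \<forall>j<r * t. i \<noteq> j \<longrightarrow> min x (1 - x\<^sup>2 / (real t - 2)) \<le> edge_density G (P i) (P j)) \<and>
    \<not> contains_traversal (r * t) G P (copies_complete r t)"
proof -
  define k where "k = t - 2"
  define m where "m = r * t"
  have k: "1 \<le> k" "real k = real t - 2" using t by (auto simp: k_def of_nat_diff)
  have ks: "k * s \<le> N" using le by (simp add: k_def)
  have m: "0 < m" using t r by (simp add: m_def)
  define P where "P i = (\<lambda>y. i * N + y) ` {..<N}" for i :: nat
  \<comment> \<open>Between two parts other than part 0, pairs are missing only within equal
    classes; positions from \<open>k * s\<close> on see everything there.\<close>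
  define R where "R u v \<longleftrightarrow> u div N \<noteq> v div N \<and>
    (if u div N = 0 then v mod N < k * s
     else if v div N = 0 then u mod N < k * s
     else \<not> (u mod N < k * s \<and> v mod N < k * s \<and> u mod N div s = v mod N div s))" for u v
  define G where "G = \<lparr>verts = {..<m * N}, edges = {{u, v} | u v. u < m * N \<and> v < m * N \<and> R u v}\<rparr>"
  have Rsym: "R u v \<longleftrightarrow> R v u" for u v unfolding R_def by auto
  have edge_iff: "{u, v} \<in> edges G \<longleftrightarrow> u < m * N \<and> v < m * N \<and> R u v" for u v
    using Rsym by (auto simp: G_def doubleton_eq_iff)
  have P_iff: "u \<in> P i \<longleftrightarrow> u div N = i" for u i
  proof
    assume "u div N = i"
    then have "u = i * N + u mod N" using div_mult_mod_eq[of u N] by simp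
    then show "u \<in> P i" using N unfolding P_def by (metis imageI lessThan_iff mod_less_divisor)
  qed (use N in \<open>auto simp: P_def\<close>)
  have vert_iff: "u < m * N \<longleftrightarrow> u div N < m" for u using N by (simp add: div_less_iff_less_mult)
  have multi: "multipartite m G P"
    unfolding multipartite_def
  proof (intro conjI)
    show "simple_graph G"
    proof -
      have "u \<noteq> v" if "R u v" for u v using that by (auto simp: R_def)
      then show ?thesis unfolding simple_graph_def by (auto simp: G_def)
    qed
    show "(\<Union>i<m. P i) = verts G" by (auto simp: P_iff G_def vert_iff)
    show "\<forall>i<m. P i \<noteq> {}" using N by (auto simp: P_def)
    show "\<forall>i<m. \<forall>j<m. i \<noteq> j \<longrightarrow> P i \<inter> P j = {}" by (auto simp: P_iff)
    show "\<forall>e\<in>edges G. \<forall>i<m. \<not> e \<subseteq> P i" by (auto simp: P_iff G_def R_def)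
  qed
  have inj: "inj_on (\<lambda>y. i * N + y) {..<N}" for i by (simp add: inj_on_def)
  have cardP: "card (P i) = N" for i by (simp add: P_def card_image inj)
  have dens: "edge_density G (P i) (P j) =
      (\<Sum>y<N. \<Sum>z<N. of_bool (R (i * N + y) (j * N + z))) / (real N)\<^sup>2"
    if ij: "i < m" "j < m" "i \<noteq> j" for i j
  proof -
    have "edge_density G (P i) (P j)
        = (\<Sum>u\<in>P i. \<Sum>v\<in>P j. of_bool ({u, v} \<in> edges G)) / (real (card (P i)) * real (card (P j)))"
    proof (rule edge_density_eq)
      show "P i \<inter> P j = {}" using ij by (auto simp: P_iff)
    qed (auto simp: P_def)
    also have "(\<Sum>u\<in>P i. \<Sum>v\<in>P j. of_bool ({u, v} \<in> edges G)) = (\<Sum>u\<in>P i. \<Sum>v\<in>P j. of_bool (R u v) :: real)"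
      using ij by (intro sum.cong refl) (auto simp: edge_iff vert_iff P_iff)
    also have "\<dots> = (\<Sum>y<N. \<Sum>z<N. of_bool (R (i * N + y) (j * N + z)))"
      by (simp add: P_def sum.reindex[OF inj] o_def)
    finally show ?thesis by (simp add: cardP power2_eq_square)
  qed
  have x: "x = real (k * s) / real N" by (simp add: x_def k_def)
  have dens0: "edge_density G (P 0) (P j) = x" if j: "j < m" "j \<noteq> 0" for j
  proof -
    have "edge_density G (P 0) (P j) = (\<Sum>y<N. \<Sum>z<N. of_bool (z < k * s)) / (real N)\<^sup>2"
      using dens[of 0 j] j m N by (simp add: R_def)
    also have "(\<Sum>z<N. of_bool (z < k * s)) = real (card ({..<N} \<inter> {z. z < k * s}))"
      by (simp add: of_bool_def sum.If_cases)
    also have "{..<N} \<inter> {z. z < k * s} = {..<k * s}" using ks by auto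
    finally show ?thesis using N by (simp add: x power2_eq_square)
  qed
  have dens1: "edge_density G (P i) (P j) = 1 - x\<^sup>2 / real k"
    if ij: "i < m" "j < m" "i \<noteq> j" "i \<noteq> 0" "j \<noteq> 0" for i j
  proof -
    let ?C = "\<lambda>y z. y < k * s \<and> z < k * s \<and> y div s = z div s"
    have div_eq: "z div s = c \<longleftrightarrow> c * s \<le> z \<and> z < c * s + s" for z c
    proof
      assume eq: "z div s = c"
      show "c * s \<le> z \<and> z < c * s + s"
        using div_mult_mod_eq[of z s] mod_less_divisor[OF s, of z] unfolding eq
        by (metis le_add1 nat_add_left_cancel_less)
    next
      assume "c * s \<le> z \<and> z < c * s + s"
      then show "z div s = c" by (intro div_nat_eqI) (auto simp: mult.commute)
    qed
    \<comment> \<open>Each of the \<open>k * s\<close> classified vertices misses exactly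
      \<open>s\<close> vertices of another such part, so the missing density is
      \<open>k * s * s / (N * N)\<close>, which is the square of \<open>x\<close> divided by
      \<open>k\<close>.\<close>
    have cls: "(\<Sum>z<N. of_bool (?C y z)) = of_bool (y < k * s) * real s" if "y < N" for y
    proof (cases "y < k * s")
      case True
      define c where "c = y div s"
      have "c < k" using True s by (simp add: c_def div_less_iff_less_mult)
      then have le: "c * s + s \<le> k * s"
        using mult_le_mono1[of "Suc c" k s] by simp
      have "z \<in> {..<N} \<inter> {z. z < k * s \<and> c = z div s} \<longleftrightarrow> z \<in> {c * s..<c * s + s}" for z
      proof -
        have "z \<in> {..<N} \<inter> {z. z < k * s \<and> c = z div s} \<longleftrightarrow> z < N \<and> z < k * s \<and> z div s = c"
          by blast
        also have "\<dots> \<longleftrightarrow> c * s \<le> z \<and> z < c * s + s"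
          unfolding div_eq using le ks by linarith
        finally show ?thesis by simp
      qed
      then have "{..<N} \<inter> {z. z < k * s \<and> c = z div s} = {c * s..<c * s + s}" by blast
      then show ?thesis using True by (simp add: of_bool_def sum.If_cases c_def[symmetric])
    qed simp
    have "(\<Sum>y<N. \<Sum>z<N. of_bool (R (i * N + y) (j * N + z))) = (\<Sum>y<N. \<Sum>z<N. 1 - of_bool (?C y z) :: real)"
      using ij N by (intro sum.cong refl) (auto simp: R_def)
    also have "\<dots> = (real N)\<^sup>2 - (\<Sum>y<N. \<Sum>z<N. of_bool (?C y z))"
      by (simp add: sum_subtractf power2_eq_square)
    also have "(\<Sum>y<N. \<Sum>z<N. of_bool (?C y z)) = (\<Sum>y<N. of_bool (y < k * s) * real s)"
      by (intro sum.cong refl cls) simp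
    also have "\<dots> = real (card ({..<N} \<inter> {z. z < k * s})) * real s"
      by (simp add: of_bool_def sum.If_cases sum_distrib_right[symmetric])
    also have "{..<N} \<inter> {z. z < k * s} = {..<k * s}" using ks by auto
    finally have "edge_density G (P i) (P j) = ((real N)\<^sup>2 - real (card {..<k * s}) * real s) / (real N)\<^sup>2"
      unfolding dens[OF ij(1-3)] by (rule arg_cong)
    also have "\<dots> = 1 - x\<^sup>2 / real k"
      using N k(1) by (simp add: x diff_divide_distrib power2_eq_square)
    finally show ?thesis .
  qed
  have "min x (1 - x\<^sup>2 / (real t - 2)) \<le> edge_density G (P i) (P j)"
    if "i < m" "j < m" "i \<noteq> j" for i j
  proof -
    consider "i = 0" "j \<noteq> 0" | "i \<noteq> 0" "j = 0" | "i \<noteq> 0" "j \<noteq> 0" using \<open>i \<noteq> j\<close> by auto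
    then show ?thesis
    proof cases
      case 1
      then show ?thesis using dens0[OF that(2)] by simp
    next
      case 2
      then show ?thesis using dens0[OF that(1)] edge_density_commute[of G "P i" "P 0"] by simp
    next
      case 3
      then show ?thesis using dens1[OF that] k(2) by simp
    qed
  qed
  moreover have "\<not> contains_traversal m G P (copies_complete r t)"
    unfolding m_def
  proof (rule no_traversal_if_part_avoids_cliques)
    fix g :: "nat \<Rightarrow> nat"
    assume g: "\<And>a b. a < t \<Longrightarrow> b < t \<Longrightarrow> a \<noteq> b \<Longrightarrow> {g a, g b} \<in> edges G"
    show "\<forall>a<t. g a \<notin> P 0"
    proof (intro allI impI notI)
      fix a assume a: "a < t" "g a \<in> P 0"
      \<comment> \<open>Pigeonhole: the other \<open>t - 1\<close> clique vertices lie outside part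
        0, in pairwise different classes, but there are only \<open>k = t - 2\<close>
        classes.\<close>
      let ?B = "{..<t} - {a}"
      have b: "g b div N \<noteq> 0 \<and> g b mod N < k * s" if "b \<in> ?B" for b
        using g[of a b] that a by (auto simp: edge_iff R_def P_iff)
      have "inj_on (\<lambda>b. g b mod N div s) ?B"
      proof (intro inj_onI)
        fix b c assume bc: "b \<in> ?B" "c \<in> ?B" "g b mod N div s = g c mod N div s"
        show "b = c" using g[of b c] bc b[OF bc(1)] b[OF bc(2)] by (auto simp: edge_iff R_def)
      qed
      moreover have "(\<lambda>b. g b mod N div s) ` ?B \<subseteq> {..<k}"
      proof (rule image_subsetI)
        fix c assume "c \<in> ?B"
        from b[OF this] show "g c mod N div s \<in> {..<k}"
          using s by (simp add: div_less_iff_less_mult)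
      qed
      ultimately have "card ?B \<le> card {..<k}" by (intro card_inj_on_le) auto
      then show False using a t by (simp add: k_def)
    qed
  qed (use multi r t in \<open>simp_all add: m_def\<close>)
  ultimately show ?thesis
    using multi unfolding m_def by (intro exI[of _ G] exI[of _ P]) simp
qed

subsection \<open>The critical density\<close>

lemma alpha_crit_properties:
  assumes "3 \<le> t"
  shows "\<exists>!x::real. 0 < x \<and> x = 1 - 1 / (real t - 2) * x\<^sup>2"
    and "alpha_crit t = 1 - (real t - sqrt ((real t)\<^sup>2 - 4)) / 2"
    and "0 < alpha_crit t" "alpha_crit t < 1" "1 - alpha_crit t = (alpha_crit t)\<^sup>2 / (real t - 2)"
proof -
  define \<alpha> where "\<alpha> = 1 - (real t - sqrt ((real t)\<^sup>2 - 4)) / 2"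
  have t: "3 \<le> real t" using assms by simp
  have "(real t - 2)\<^sup>2 < (real t)\<^sup>2 - 4" using t by (simp add: power2_eq_square algebra_simps)
  then have "real t - 2 < sqrt ((real t)\<^sup>2 - 4)" by (rule real_less_rsqrt)
  then have pos: "0 < \<alpha>" by (simp add: \<alpha>_def)
  have "(real t)\<^sup>2 - 4 \<ge> 0" using power_mono[OF t, of 2] by simp
  then have sq: "(sqrt ((real t)\<^sup>2 - 4))\<^sup>2 = (real t)\<^sup>2 - 4" by simp
  have "sqrt ((real t)\<^sup>2 - 4) = 2 * \<alpha> + (real t - 2)" unfolding \<alpha>_def by argo
  with sq have "(2 * \<alpha> + (real t - 2))\<^sup>2 = (real t)\<^sup>2 - 4" by simp
  then have quad: "\<alpha>\<^sup>2 = (1 - \<alpha>) * (real t - 2)"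
    by (simp add: power2_eq_square algebra_simps)
  then have eq: "1 - \<alpha> = \<alpha>\<^sup>2 / (real t - 2)" using t by (simp add: field_simps)
  then have "0 < 1 - \<alpha>" using pos t by simp
  have "1 / (real t - 2) * \<alpha>\<^sup>2 = \<alpha>\<^sup>2 / (real t - 2)" by simp
  with eq have eq': "\<alpha> = 1 - 1 / (real t - 2) * \<alpha>\<^sup>2" by linarith
  have uniq: "x = \<alpha>" if "0 < x" "x = 1 - 1 / (real t - 2) * x\<^sup>2" for x
  proof -
    have "1 - x = x\<^sup>2 / (real t - 2)" using that(2) by simp
    then have "x\<^sup>2 = (1 - x) * (real t - 2)" using t by (simp add: field_simps)
    \<comment> \<open>Subtracting the two quadratic equations leaves a product whose second factor
      is positive.\<close>
    with quad have "(x - \<alpha>) * (x + \<alpha> + (real t - 2)) = 0"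
      by (simp add: power2_eq_square algebra_simps)
    moreover have "0 < x + \<alpha> + (real t - 2)" using that(1) pos t by simp
    ultimately show ?thesis by simp
  qed
  show "\<exists>!x::real. 0 < x \<and> x = 1 - 1 / (real t - 2) * x\<^sup>2"
    by (rule ex1I[of _ \<alpha>]) (use pos eq' uniq in blast)+
  have "alpha_crit t = \<alpha>"
    unfolding alpha_crit_def using pos eq' uniq by (intro the_equality) blast+
  then show "alpha_crit t = 1 - (real t - sqrt ((real t)\<^sup>2 - 4)) / 2"
    by (simp only: \<alpha>_def)
  show "0 < alpha_crit t" "alpha_crit t < 1" "1 - alpha_crit t = (alpha_crit t)\<^sup>2 / (real t - 2)"
    unfolding \<open>alpha_crit t = \<alpha>\<close> using pos \<open>0 < 1 - \<alpha>\<close> eq by simp_all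
qed

text \<open>The construction realises rational \<open>x\<close> only, so \<open>x\<close> is taken
  strictly between \<open>\<beta>\<close> and \<open>\<alpha>\<^sub>t\<close>. For such
  \<open>x\<close> the other density \<open>1 - x^2 / (t - 2)\<close> is at least
  \<open>\<alpha>\<^sub>t\<close>.\<close>

lemma avoidable_density_below_alpha_crit:
  assumes t: "3 \<le> t" and r: "1 \<le> r" and \<beta>: "0 < \<beta>" "\<beta> < alpha_crit t"
  shows "\<exists>(G :: nat ugraph) P. multipartite (r * t) G P \<and> \<beta> \<le> multipartite_density (r * t) G P \<and>
    \<not> contains_traversal (r * t) G P (copies_complete r t)"
proof -
  note \<alpha> = alpha_crit_properties[OF t]
  obtain x where x: "x \<in> \<rat>" "\<beta> < x" "x < alpha_crit t"
    using Rats_dense_in_real[OF \<beta>(2)] by blast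
  obtain p q :: nat where pq: "q \<noteq> 0" "\<bar>x\<bar> = real p / real q"
    using Rats_abs_nat_div_natE[OF x(1)] by metis
  have xpq: "x = real p / real q" using pq x \<beta> by simp
  have p: "0 < p" using xpq x(2) \<beta>(1) by (cases "p = 0") auto
  have "x < 1" using x(3) \<alpha>(4) by simp
  then have "p \<le> q" using pq xpq by (simp add: field_simps)
  have k: "0 < t - 2" using t by simp
  have r2: "2 \<le> r * t" using mult_le_mono[OF r t] by simp
  \<comment> \<open>With class size \<open>p\<close> and part size \<open>(t - 2) * q\<close>, the
    factor \<open>t - 2\<close> cancels and the construction's fraction is exactly
    \<open>x\<close>.\<close>
  have "real ((t - 2) * p) / real ((t - 2) * q) = x" using k by (simp add: xpq)
  with traversal_free_construction[of t r "(t - 2) * q" p]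
  obtain G :: "nat ugraph" and P where G: "multipartite (r * t) G P"
      "\<not> contains_traversal (r * t) G P (copies_complete r t)"
    and dens: "\<And>i j. i < r * t \<Longrightarrow> j < r * t \<Longrightarrow> i \<noteq> j \<Longrightarrow>
      min x (1 - x\<^sup>2 / (real t - 2)) \<le> edge_density G (P i) (P j)"
    using t r p k pq \<open>p \<le> q\<close> by auto
  have "x\<^sup>2 \<le> (alpha_crit t)\<^sup>2" using x \<beta> by (intro power_mono) auto
  then have "x\<^sup>2 / (real t - 2) \<le> 1 - alpha_crit t"
    unfolding \<alpha>(5) using t by (intro divide_right_mono) auto
  then have "\<beta> \<le> min x (1 - x\<^sup>2 / (real t - 2))" using x \<beta> by simp
  then have "\<beta> \<le> multipartite_density (r * t) G P"
    unfolding multipartite_density_ge_iff[OF r2] using dens by (meson order_trans)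
  then show ?thesis using G by blast
qed

text \<open>Every \<open>\<beta>\<close> below \<open>\<alpha>\<^sub>t\<close> belongs to the set
  whose supremum is taken, and that set is bounded above by 1.\<close>

lemma alpha_crit_le_critical_density:
  assumes t: "3 \<le> t" and r: "1 \<le> r"
  shows "alpha_crit t \<le> critical_density (r * t) (copies_complete r t)"
proof (rule dense_le_bounded[OF alpha_crit_properties(3)[OF t]])
  fix \<beta> assume \<beta>: "0 < \<beta>" "\<beta> < alpha_crit t"
  have "\<beta> \<le> 1" using \<beta>(2) alpha_crit_properties(4)[OF t] by simp
  then show "\<beta> \<le> critical_density (r * t) (copies_complete r t)"
    unfolding critical_density_def using avoidable_density_below_alpha_crit[OF t r \<beta>] \<beta>(1)
    by (intro cSup_upper) (auto intro!: bdd_aboveI[of _ 1])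
qed

text \<open>\<open>L\<close> depends only on \<open>\<epsilon>\<close>, so the threshold
  \<open>m0\<close> from \<open>perfect_tiling\<close> is uniform over all host graphs.\<close>

lemma critical_density_eventually_le:
  assumes t: "3 \<le> t" and \<epsilon>: "0 < \<epsilon>"
  shows "\<exists>r0. \<forall>r\<ge>r0. critical_density (r * t) (copies_complete r t) \<le> alpha_crit t + \<epsilon>"
proof -
  note \<alpha> = alpha_crit_properties[OF t]
  \<comment> \<open>The least integer meeting the size condition of
    \<open>clique_through_part\<close>.\<close>
  define L where "L = nat \<lceil>(1 + 1 / \<epsilon>) / \<epsilon>\<rceil>"
  have "(1 + 1 / \<epsilon>) / \<epsilon> \<le> real L" unfolding L_def by linarith
  then have L: "1 + 1 / \<epsilon> \<le> \<epsilon> * real L" using \<epsilon> by (simp add: pos_divide_le_eq mult.commute)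
  have "1 \<le> t" using t by simp
  from perfect_tiling[OF this, where L = L and 'a = nat]
  obtain m0 where m0: "\<forall>(V::nat set) H. finite V \<longrightarrow> m0 \<le> card V \<longrightarrow> t dvd card V \<longrightarrow> (\<forall>e\<in>H. card e = t) \<longrightarrow>
    (\<forall>i\<in>V. \<forall>J\<subseteq>V - {i}. card J = L \<longrightarrow> (\<exists>T\<subseteq>J. card T = t - 1 \<and> insert i T \<in> H)) \<longrightarrow>
    tileable H V"
    by (elim exE) (rule that)
  note m0 = m0[THEN spec, THEN spec, THEN mp, THEN mp, THEN mp, THEN mp, THEN mp]
  show ?thesis
  proof (intro exI[of _ "max 1 m0"] allI impI)
    fix r assume "max 1 m0 \<le> r"
    then have r: "1 \<le> r" "m0 \<le> r" by auto
    have r2: "2 \<le> r * t" using mult_le_mono[OF r(1) t] by simp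
    have m0r: "m0 \<le> r * t" using mult_le_mono[OF r(2), of 1 t] t by simp
    have contains: "contains_traversal (r * t) G P (copies_complete r t)"
      if G: "multipartite (r * t) G P" and d: "alpha_crit t + \<epsilon> \<le> multipartite_density (r * t) G P"
      for G :: "nat ugraph" and P
    proof (rule contains_traversal_if_tileable[OF G])
      show "tileable {I. card I = t \<and> spans_clique G P I} {..<r * t}"
      proof (rule m0)
        show "\<forall>i\<in>{..<r * t}. \<forall>J\<subseteq>{..<r * t} - {i}. card J = L \<longrightarrow>
          (\<exists>T\<subseteq>J. card T = t - 1 \<and> insert i T \<in> {I. card I = t \<and> spans_clique G P I})"
        proof (intro ballI allI impI)
          fix i J assume i: "i \<in> {..<r * t}" and J: "J \<subseteq> {..<r * t} - {i}" "card J = L"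
          have "\<exists>T\<subseteq>J. card T = t - 1 \<and> spans_clique G P (insert i T)"
            using d i J L unfolding multipartite_density_ge_iff[OF r2]
            by (intro clique_through_part[OF G t \<alpha>(3-5) \<epsilon>]) auto
          then obtain T where T: "T \<subseteq> J" "card T = t - 1" "spans_clique G P (insert i T)" by blast
          have "finite T" "i \<notin> T" using T(1) J(1) finite_subset[of T "{..<r * t}"] by auto
          then have "card (insert i T) = t" using T(2) t by simp
          then show "\<exists>T\<subseteq>J. card T = t - 1 \<and> insert i T \<in> {I. card I = t \<and> spans_clique G P I}"
            using T by blast
        qed
      qed (use m0r in auto)
    qed (use t in simp)
    show "critical_density (r * t) (copies_complete r t) \<le> alpha_crit t + \<epsilon>"
      unfolding critical_density_def
    proof (rule cSup_least)
      \<comment> \<open>A supremum of reals is bounded this way only if the set is nonempty; half of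
        \<open>\<alpha>\<^sub>t\<close> is a member.\<close>
      obtain G :: "nat ugraph" and P where "multipartite (r * t) G P"
        "alpha_crit t / 2 \<le> multipartite_density (r * t) G P"
        "\<not> contains_traversal (r * t) G P (copies_complete r t)"
        using avoidable_density_below_alpha_crit[OF t r(1), of "alpha_crit t / 2"] \<alpha>(3) by auto
      moreover have "0 \<le> alpha_crit t / 2" "alpha_crit t / 2 \<le> 1"
        using \<alpha>(3,4) by auto
      ultimately
      show "{\<beta>. 0 \<le> \<beta> \<and> \<beta> \<le> 1 \<and> (\<exists>(G :: nat ugraph) P. multipartite (r * t) G P \<and>
          \<beta> \<le> multipartite_density (r * t) G P \<and>
          \<not> contains_traversal (r * t) G P (copies_complete r t))} \<noteq> {}"
        by blast
    next
      fix \<beta>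
      assume "\<beta> \<in> {\<beta>. 0 \<le> \<beta> \<and> \<beta> \<le> 1 \<and> (\<exists>(G :: nat ugraph) P. multipartite (r * t) G P \<and>
          \<beta> \<le> multipartite_density (r * t) G P \<and>
          \<not> contains_traversal (r * t) G P (copies_complete r t))}"
      then obtain G :: "nat ugraph" and P where "multipartite (r * t) G P"
          "\<beta> \<le> multipartite_density (r * t) G P" "\<not> contains_traversal (r * t) G P (copies_complete r t)"
        by blast
      then show "\<beta> \<le> alpha_crit t + \<epsilon>" using contains[of G P] by linarith
    qed
  qed
qed

theorem theorem1p4:
  fixes t :: nat
  assumes "t \<ge> 3"
  shows "(\<exists>!x::real. 0 < x \<and> x = 1 - 1 / (real t - 2) * x\<^sup>2) \<and>
    alpha_crit t = 1 - (real t - sqrt ((real t)\<^sup>2 - 4)) / 2 \<and>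
    (\<forall>r\<ge>1. critical_density (r * t) (copies_complete r t) \<ge> alpha_crit t) \<and>
    (\<lambda>r. critical_density (r * t) (copies_complete r t)) \<longlonglongrightarrow> alpha_crit t"
proof (intro conjI)
  show "\<exists>!x::real. 0 < x \<and> x = 1 - 1 / (real t - 2) * x\<^sup>2"
    "alpha_crit t = 1 - (real t - sqrt ((real t)\<^sup>2 - 4)) / 2"
    by (rule alpha_crit_properties[OF assms])+
  show lower: "\<forall>r\<ge>1. critical_density (r * t) (copies_complete r t) \<ge> alpha_crit t"
    using alpha_crit_le_critical_density[OF assms] by blast
  show "(\<lambda>r. critical_density (r * t) (copies_complete r t)) \<longlonglongrightarrow> alpha_crit t"
  proof (rule LIMSEQ_I)
    fix \<epsilon> :: real assume \<epsilon>: "0 < \<epsilon>"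
    obtain r0 where r0: "\<And>r. r0 \<le> r \<Longrightarrow>
        critical_density (r * t) (copies_complete r t) \<le> alpha_crit t + \<epsilon> / 2"
      using critical_density_eventually_le[OF assms half_gt_zero[OF \<epsilon>]] by blast
    \<comment> \<open>The lower bound holds from \<open>r = 1\<close> on, and the upper one with
      \<open>\<epsilon> / 2\<close> makes the inequality strict.\<close>
    have "norm (critical_density (r * t) (copies_complete r t) - alpha_crit t) < \<epsilon>"
      if "max 1 r0 \<le> r" for r
      using that lower[rule_format, of r] r0[of r] \<epsilon> by simp
    then show "\<exists>r0. \<forall>r\<ge>r0. norm (critical_density (r * t) (copies_complete r t) - alpha_crit t) < \<epsilon>"
      by blast
  qed
qed

end
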